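(* Let $W:\mathcal{X}\to\mathcal{P}(\mathsf{Y})$ be a discrete channel and, for each $n$, let $W_{\vec{[1,n]}}$ be the length $n$ discrete stationary product channel with feedback all of whose components equal $W$. Let $0<\alpha_0<\alpha_1<1$. Then for any sequence of codes, the $n$-th being an $(M_n,L_n)$ channel code on $W_{\vec{[1,n]}}$ with average error probability $P_e^{(n)}$, satisfying $$C_{\alpha_1,W}\ge\frac1n\ln\frac{M_n}{L_n}\ge C_{\alpha_0,W}+\frac{\ln n}{n^{1/4}}\quad\forall n\ge n_0$$ for some $n_0$, there exists $n_1\ge n_0$ such that $$P_e^{(n)}\ge \exp\Big(-n\Big[E_{sp}\big(\tfrac1n\ln\tfrac{M_n}{L_n},W\big)+\tfrac{1}{\alpha_0}\tfrac{\ln n}{n^{1/4}}\Big]\Big)\quad\forall n\ge n_1.$$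
   Context: A discrete channel $W$ is a map from a finite input set $\mathcal{X}$ to probability distributions on a finite output set $\mathsf{Y}$. The length $n$ discrete product channel with feedback built from discrete channels $W_t:\mathcal{X}_t\to\mathcal{P}(\mathsf{Y}_t)$ has input set $\mathcal{X}_1\times\prod_{t=2}^n\mathcal{X}_t^{\mathsf{Y}_1\times\cdots\times\mathsf{Y}_{t-1}}$ (an input is $(x_1,e_2,\dots,e_n)$ with $e_t$ a function of the past outputs), output set $\mathsf{Y}_1\times\cdots\times\mathsf{Y}_n$, and transition probabilities $W(y|x)=W_1(y_1|x_1)\prod_{t=2}^nW_t(y_t|e_t(y_1,\dots,y_{t-1}))$; it is stationary if all $W_t$ are equal. An $(M,L)$ channel code consists of an encoder $f:\{1,\dots,M\}\to$ input set and a decoder $\psi$ from the output set to the $L$-element subsets of $\{1,\dots,M\}$; average error probability $P_e=\frac1M\sum_m W(f(m))(\{y:m\notin\psi(y)\})$. Rényi divergence for distributions: $D_\alpha(w\|q)=\frac{1}{\alpha-1}\ln\sum_y w(y)^\alpha q(y)^{1-\alpha}$ ($\alpha\ne1$), $D_1(w\|q)=\sum_yw(y)\ln\frac{w(y)}{q(y)}$. Rényi information $I_\alpha(p;W)=\frac{\alpha}{\alpha-1}\ln\sum_y(\sum_xp(x)W(y|x)^\alpha)^{1/\alpha}$ ($\alpha\neq1$), $I_1$ the mutual information; Rényi capacity $C_{\alpha,W}=\sup_pI_\alpha(p;W)$. Sphere packing exponent $E_{sp}(R,W)=\sup_{\alpha\in(0,\infty)}\frac{1-\alpha}{\alpha}(C_{\alpha,W}-R)$.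 *)

theory Defs
  imports Complex_Main
begin

definition discrete_channel :: "('x::finite \<Rightarrow> 'y::finite \<Rightarrow> real) \<Rightarrow> bool" where
  "discrete_channel W \<longleftrightarrow> (\<forall>x y. 0 \<le> W x y) \<and> (\<forall>x. (\<Sum>y\<in>UNIV. W x y) = 1)"

definition prob_dist :: "('x::finite \<Rightarrow> real) \<Rightarrow> bool" where
  "prob_dist p \<longleftrightarrow> (\<forall>x. 0 \<le> p x) \<and> (\<Sum>x\<in>UNIV. p x) = 1"

definition renyi_info :: "real \<Rightarrow> ('x::finite \<Rightarrow> real) \<Rightarrow> ('x \<Rightarrow> 'y::finite \<Rightarrow> real) \<Rightarrow> real" where
  "renyi_info \<alpha> p W =
    (if \<alpha> = 1 then
       (\<Sum>x\<in>UNIV. \<Sum>y\<in>UNIV.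
          if p x * W x y = 0 then 0
          else p x * W x y * ln (W x y / (\<Sum>x'\<in>UNIV. p x' * W x' y)))
     else \<alpha> / (\<alpha> - 1) *
       ln (\<Sum>y\<in>UNIV. (\<Sum>x\<in>UNIV. p x * W x y powr \<alpha>) powr (1 / \<alpha>)))"

definition renyi_capacity :: "real \<Rightarrow> ('x::finite \<Rightarrow> 'y::finite \<Rightarrow> real) \<Rightarrow> real" where
  "renyi_capacity \<alpha> W = (SUP p\<in>{p. prob_dist p}. renyi_info \<alpha> p W)"

definition sphere_packing_exp :: "real \<Rightarrow> ('x::finite \<Rightarrow> 'y::finite \<Rightarrow> real) \<Rightarrow> real" where
  "sphere_packing_exp R W = (SUP \<alpha>\<in>{0<..}. (1 - \<alpha>) / \<alpha> * (renyi_capacity \<alpha> W - R))"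

text \<open>Length n stationary product channel with feedback built from W.
  An input is encoded as a function e from output prefixes to inputs: the input
  at time t (0-based) is e applied to the first t outputs (so e [] is x_1 and
  e restricted to lists of length t-1 is e_t). Output set: lists of length n.\<close>
definition feedback_outputs :: "nat \<Rightarrow> 'y::finite list set" where
  "feedback_outputs n = {ys. length ys = n}"

definition feedback_prob ::
  "('x \<Rightarrow> 'y \<Rightarrow> real) \<Rightarrow> nat \<Rightarrow> ('y list \<Rightarrow> 'x) \<Rightarrow> 'y list \<Rightarrow> real" where
  "feedback_prob W n e ys = (\<Prod>t<n. W (e (take t ys)) (ys ! t))"

definition is_list_code ::
  "nat \<Rightarrow> nat \<Rightarrow> nat \<Rightarrow> (nat \<Rightarrow> 'y::finite list \<Rightarrow> 'x) \<Rightarrow> ('y list \<Rightarrow> nat set) \<Rightarrow> bool" where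
  "is_list_code n M L f \<psi> \<longleftrightarrow> 1 \<le> L \<and> L \<le> M \<and>
     (\<forall>ys\<in>feedback_outputs n. \<psi> ys \<subseteq> {1..M} \<and> card (\<psi> ys) = L)"

definition avg_error ::
  "('x \<Rightarrow> 'y::finite \<Rightarrow> real) \<Rightarrow> nat \<Rightarrow> nat \<Rightarrow> (nat \<Rightarrow> 'y list \<Rightarrow> 'x) \<Rightarrow> ('y list \<Rightarrow> nat set) \<Rightarrow> real" where
  "avg_error W n M f \<psi> =
     (1 / real M) * (\<Sum>m\<in>{1..M}. \<Sum>ys\<in>{ys\<in>feedback_outputs n. m \<notin> \<psi> ys}. feedback_prob W n (f m) ys)"

end

theory Submission
  imports Defs "HOL-Analysis.Analysis"
begin

text \<open>
  Feedback outputs are cut into blocks of length about \<open>\<surd>n\<close>. On every block the output law is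
  compared with one fixed reference measure, the average of the product measures built from the
  Renyi centers of a fine grid of orders and the uniform distribution (Augustin's averaging).
  Given the past and the message, the block law \<open>P\<close> is tilted towards the reference \<open>Q\<close> to
  \<open>V \<propto> P\<^sup>\<alpha> Q\<^sup>1\<^sup>-\<^sup>\<alpha>\<close>, where the intermediate value theorem provides an \<open>\<alpha>\<close>, depending on the past,
  with \<open>D(V\<parallel>Q)\<close> slightly below the rate of the block; then \<open>D(V\<parallel>P)\<close> is at most the sphere packing
  exponent of the block up to lower order terms. As the reference does not depend on \<open>\<alpha>\<close>, no
  continuity of the Renyi centers is needed. Second order bounds on the exponential moments of the
  two log-likelihood ratios multiply over the blocks, and a change of measure from \<open>V\<close> gives the error bound.
\<close>

section \<open>Renyi centers and capacities\<close>

text \<open>With feedback the law of a block depends on the past, and one order of tilting need not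
  suit all pasts: the divergence from the reference could run high after some outputs and low after
  others, and the likelihood ratios would not concentrate. Pinning the divergence block by block,
  given the past, yields conditional moment bounds that are free of the past. The reference cannot
  adapt in the same way, because the decoding lists are counted with one measure common to all
  messages; it has to be good for all orders at once. Averaging N laws costs only ln N per block,
  and a center of one order also serves every smaller order, so a finite grid is enough. The block
  length is a compromise: k blocks of length l lose about k ln l by averaging and k s l^2 + 1 / s by
  the second order terms, which is of order sqrt (n l) for the best s. At l = sqrt n this is
  n^(3/4), within a loss of n^(-1/4) ln n per letter.\<close>

lemma Holder_sum_powr:
  fixes a b :: "'i \<Rightarrow> real"
  assumes "finite A" "\<And>i. i \<in> A \<Longrightarrow> 0 \<le> a i" "\<And>i. i \<in> A \<Longrightarrow> 0 \<le> b i"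
    and "0 < \<theta>" "\<theta> < 1"
  shows "(\<Sum>i\<in>A. a i powr \<theta> * b i powr (1 - \<theta>)) \<le> (\<Sum>i\<in>A. a i) powr \<theta> * (\<Sum>i\<in>A. b i) powr (1 - \<theta>)"
proof (cases "(\<Sum>i\<in>A. a i) = 0 \<or> (\<Sum>i\<in>A. b i) = 0")
  case True
  then have "\<forall>i\<in>A. a i powr \<theta> * b i powr (1 - \<theta>) = 0"
    using assms by (auto simp: sum_nonneg_eq_0_iff)
  then have "(\<Sum>i\<in>A. a i powr \<theta> * b i powr (1 - \<theta>)) = 0"
    by (intro sum.neutral) auto
  then show ?thesis by simp
next
  case False
  define s where "s = (\<Sum>i\<in>A. a i)"
  define t where "t = (\<Sum>i\<in>A. b i)"
  have st: "s > 0" "t > 0"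
    using False assms unfolding s_def t_def by (auto simp: less_le sum_nonneg)
  \<comment> \<open>Young's inequality for the terms normalized by their sums; the right sides then
    add up to 1.\<close>
  have term_le: "(a i / s) powr \<theta> * (b i / t) powr (1 - \<theta>) \<le> \<theta> * (a i / s) + (1 - \<theta>) * (b i / t)"
    if "i \<in> A" for i
  proof (cases "a i = 0 \<or> b i = 0")
    case True
    then show ?thesis using assms that st by auto
  next
    case False
    then have "a i > 0" "b i > 0" using assms that by (auto simp: less_le)
    then show ?thesis using st assms by (intro Youngs_inequality_0) auto
  qed
  have "(\<Sum>i\<in>A. a i powr \<theta> * b i powr (1 - \<theta>)) / (s powr \<theta> * t powr (1 - \<theta>))
      = (\<Sum>i\<in>A. (a i / s) powr \<theta> * (b i / t) powr (1 - \<theta>))"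
    using assms st by (simp add: sum_divide_distrib powr_divide)
  also have "\<dots> \<le> (\<Sum>i\<in>A. \<theta> * (a i / s) + (1 - \<theta>) * (b i / t))"
    by (intro sum_mono term_le)
  also have "\<dots> = \<theta> * (s / s) + (1 - \<theta>) * (t / t)"
    by (simp add: sum.distrib s_def t_def flip: sum_distrib_left sum_divide_distrib)
  also have "\<dots> = 1" using st by simp
  finally show ?thesis
    using st by (simp add: divide_le_eq flip: s_def t_def)
qed

text \<open>Convexity of the power r, derived from Young's inequality so that no derivative is taken
  at 0. It is used with r = 1 / \<alpha>.\<close>

lemma powr_tangent_le:
  fixes x y r :: real
  assumes "0 \<le> x" "0 \<le> y" "1 < r"
  shows "x powr r - y powr r \<le> r * x powr (r - 1) * (x - y)"
proof -
  have "y * x powr (r - 1) \<le> y powr r / r + (x powr (r - 1)) powr (r / (r - 1)) / (r / (r - 1))"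
    using assms by (intro Youngs_inequality) (auto simp: field_simps)
  also have "(x powr (r - 1)) powr (r / (r - 1)) = x powr r"
    using assms by (simp add: powr_powr)
  finally have "r * (y * x powr (r - 1)) \<le> y powr r + (r - 1) * x powr r"
    using assms by (simp add: field_simps)
  moreover have "x powr (r - 1) * x = x powr r"
    using assms by (cases "x = 0") (auto simp: powr_diff)
  ultimately show ?thesis by (simp add: algebra_simps)
qed

text \<open>With \<rho> = (1 - \<alpha>) / \<alpha> this is exp (- E0 (\<rho>, p)) for Gallager's
  function E0. As \<alpha> / (\<alpha> - 1) < 0 for \<alpha> < 1, maximizing Renyi information of
  such an order means minimizing this sum, which is convex in p.\<close>

definition gallager_sum :: "real \<Rightarrow> ('x::finite \<Rightarrow> real) \<Rightarrow> ('x \<Rightarrow> 'y::finite \<Rightarrow> real) \<Rightarrow> real" where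
  "gallager_sum \<alpha> p W = (\<Sum>y\<in>UNIV. (\<Sum>x\<in>UNIV. p x * W x y powr \<alpha>) powr (1 / \<alpha>))"

lemma channel_nonneg: "discrete_channel W \<Longrightarrow> 0 \<le> W x y"
  and channel_sum: "discrete_channel W \<Longrightarrow> (\<Sum>y\<in>UNIV. W x y) = 1"
  by (auto simp: discrete_channel_def)

lemma channel_le_1: "discrete_channel W \<Longrightarrow> W x y \<le> 1"
  using member_le_sum[of y UNIV "W x"] by (simp add: discrete_channel_def)

text \<open>Weak duality: one output law q bounds the sum from below for all p. Averaging the
  hypothesis over p and applying Hoelder's inequality eliminates q, as in Sibson's identity.\<close>

lemma gallager_sum_ge:
  assumes W: "discrete_channel W" and p: "prob_dist p" and q: "prob_dist q" and \<alpha>: "0 < \<alpha>" "\<alpha> < 1"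
    and le: "\<And>x. B \<le> (\<Sum>y\<in>UNIV. W x y powr \<alpha> * q y powr (1 - \<alpha>))" and "0 \<le> B"
  shows "B powr (1 / \<alpha>) \<le> gallager_sum \<alpha> p W"
proof -
  let ?g = "\<lambda>y. \<Sum>x\<in>UNIV. p x * W x y powr \<alpha>"
  have g0: "0 \<le> ?g y" for y using p by (intro sum_nonneg) (auto simp: prob_dist_def)
  have "B = (\<Sum>x\<in>UNIV. p x * B)" using p by (simp add: prob_dist_def flip: sum_distrib_right)
  also have "\<dots> \<le> (\<Sum>x\<in>UNIV. p x * (\<Sum>y\<in>UNIV. W x y powr \<alpha> * q y powr (1 - \<alpha>)))"
    using p le by (intro sum_mono mult_left_mono) (auto simp: prob_dist_def)
  also have "\<dots> = (\<Sum>y\<in>UNIV. ?g y * q y powr (1 - \<alpha>))"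
    unfolding sum_distrib_left sum_distrib_right by (subst sum.swap) (simp add: mult_ac)
  also have "\<dots> = (\<Sum>y\<in>UNIV. (?g y powr (1/\<alpha>)) powr \<alpha> * q y powr (1 - \<alpha>))"
    using g0 \<alpha> by (simp add: powr_powr)
  also have "\<dots> \<le> (gallager_sum \<alpha> p W) powr \<alpha> * (\<Sum>y\<in>UNIV. q y) powr (1 - \<alpha>)"
    unfolding gallager_sum_def using q \<alpha> by (intro Holder_sum_powr) (auto simp: prob_dist_def)
  also have "\<dots> = (gallager_sum \<alpha> p W) powr \<alpha>"
    using q by (simp add: prob_dist_def)
  finally have "B powr (1/\<alpha>) \<le> ((gallager_sum \<alpha> p W) powr \<alpha>) powr (1/\<alpha>)"
    using \<alpha> \<open>0 \<le> B\<close> by (intro powr_mono2) auto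
  also have "\<dots> = gallager_sum \<alpha> p W"
    using \<alpha> by (simp add: powr_powr gallager_sum_def sum_nonneg)
  finally show ?thesis .
qed

section \<open>Bounds on capacities from an output law\<close>

lemma uniform_prob_dist: "prob_dist (\<lambda>y::'y::finite. 1 / real CARD('y))"
  by (simp add: prob_dist_def)

text \<open>Probabilities are at most 1, so W <= W powr \<alpha>. This supplies the a priori bounds
  for orders below 1 and the positivity of the minimal \<open>gallager_sum\<close>.\<close>

lemma uniform_tilted_sum_ge:
  fixes W :: "'x::finite \<Rightarrow> 'y::finite \<Rightarrow> real"
  assumes W: "discrete_channel W" and \<alpha>: "0 < \<alpha>" "\<alpha> < 1"
  shows "exp ((\<alpha> - 1) * ln CARD('y)) \<le> (\<Sum>y\<in>UNIV. W x y powr \<alpha> * (1 / real CARD('y)) powr (1 - \<alpha>))"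
proof -
  have "W x y \<le> W x y powr \<alpha>" for y
    using powr_mono'[of \<alpha> 1 "W x y"] \<alpha> channel_nonneg[OF W] channel_le_1[OF W] by simp
  then have "1 \<le> (\<Sum>y\<in>UNIV. W x y powr \<alpha>)"
    using channel_sum[OF W, of x] by (metis sum_mono)
  moreover have "exp ((\<alpha> - 1) * ln CARD('y)) = (1 / real CARD('y)) powr (1 - \<alpha>)"
    by (simp add: powr_def ln_div algebra_simps)
  ultimately show ?thesis
    by (simp flip: sum_distrib_right)
qed

text \<open>The last hypothesis is the divergence bound D(W x || q) <= c of order \<alpha> without
  its logarithm; the sign of \<alpha> - 1 reverses the inequality. Divergence bounds keep this form
  below, since it multiplies over letters.\<close>

lemma renyi_info_le:
  assumes W: "discrete_channel W" and p: "prob_dist p" and q: "prob_dist q" and \<alpha>: "0 < \<alpha>" "\<alpha> < 1"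
    and le: "\<And>x. exp ((\<alpha> - 1) * c) \<le> (\<Sum>y\<in>UNIV. W x y powr \<alpha> * q y powr (1 - \<alpha>))"
  shows "renyi_info \<alpha> p W \<le> c"
proof -
  have "exp ((\<alpha> - 1) * c / \<alpha>) \<le> gallager_sum \<alpha> p W"
    using gallager_sum_ge[OF W p q \<alpha> le] by (simp add: powr_def)
  then have "(\<alpha> - 1) * c / \<alpha> \<le> ln (gallager_sum \<alpha> p W)"
    by (meson exp_gt_zero less_le_trans ln_ge_iff)
  then have "\<alpha> / (\<alpha> - 1) * ln (gallager_sum \<alpha> p W) \<le> \<alpha> / (\<alpha> - 1) * ((\<alpha> - 1) * c / \<alpha>)"
    using \<alpha> by (intro mult_left_mono_neg) (auto simp: divide_nonneg_neg divide_nonneg_nonpos)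
  then show ?thesis using \<alpha> by (simp add: renyi_info_def gallager_sum_def)
qed

lemma prob_dist_point: "prob_dist (\<lambda>x::'x::finite. if x = x0 then 1 else 0)"
  by (auto simp: prob_dist_def)

lemma renyi_capacity_le:
  assumes W: "discrete_channel W" and q: "prob_dist q" and \<alpha>: "0 < \<alpha>" "\<alpha> < 1"
    and le: "\<And>x. exp ((\<alpha> - 1) * c) \<le> (\<Sum>y\<in>UNIV. W x y powr \<alpha> * q y powr (1 - \<alpha>))"
  shows "renyi_capacity \<alpha> W \<le> c"
  unfolding renyi_capacity_def
  using prob_dist_point renyi_info_le[OF W _ q \<alpha> le] by (intro cSUP_least) auto

lemma renyi_capacity_le_ln_card:
  fixes W :: "'x::finite \<Rightarrow> 'y::finite \<Rightarrow> real"
  assumes W: "discrete_channel W" and \<alpha>: "0 < \<alpha>" "\<alpha> < 1"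
  shows "renyi_capacity \<alpha> W \<le> ln CARD('y)"
  using renyi_capacity_le[OF W uniform_prob_dist \<alpha> uniform_tilted_sum_ge[OF W \<alpha>]] .

text \<open>A real \<open>SUP\<close> can be compared with its members only if the set is bounded.
  Orders above 1 are included because the supremum in \<open>sphere_packing_exp\<close> runs over
  them.\<close>

lemma bdd_above_renyi_info:
  fixes W :: "'x::finite \<Rightarrow> 'y::finite \<Rightarrow> real"
  assumes W: "discrete_channel W" and \<alpha>: "0 < \<alpha>" "\<alpha> \<noteq> 1"
  shows "bdd_above ((\<lambda>p. renyi_info \<alpha> p W) ` {p. prob_dist p})"
proof (cases "\<alpha> < 1")
  case True
  then show ?thesis
    using renyi_info_le[OF W _ uniform_prob_dist _ _ uniform_tilted_sum_ge[OF W]] \<alpha>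
    by (intro bdd_aboveI2) auto
next
  case False
  then have \<alpha>1: "1 < \<alpha>" using \<alpha> by auto
  show ?thesis
  proof (intro bdd_aboveI2)
    fix p :: "'x \<Rightarrow> real" assume "p \<in> {p. prob_dist p}"
    then have p: "prob_dist p" by simp
    have "(\<Sum>x\<in>UNIV. p x * W x y powr \<alpha>) \<le> (\<Sum>x\<in>UNIV. p x * 1)" for y
      using p channel_nonneg[OF W] channel_le_1[OF W] \<alpha>
      by (intro sum_mono mult_left_mono powr_le1) (auto simp: prob_dist_def)
    then have 1: "(\<Sum>x\<in>UNIV. p x * W x y powr \<alpha>) \<le> 1" for y
      using p by (simp add: prob_dist_def)
    have 0: "0 \<le> (\<Sum>x\<in>UNIV. p x * W x y powr \<alpha>)" for y
      using p by (intro sum_nonneg) (auto simp: prob_dist_def)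
    have "gallager_sum \<alpha> p W \<le> (\<Sum>y\<in>(UNIV::'y set). 1)"
      unfolding gallager_sum_def using 0 1 \<alpha> by (intro sum_mono powr_le1) auto
    then have *: "gallager_sum \<alpha> p W \<le> CARD('y)" by simp
    have "gallager_sum \<alpha> p W \<ge> 0" by (simp add: gallager_sum_def sum_nonneg)
    \<comment> \<open>The value 0 would also be covered, as \<open>ln 0 = 0\<close> and the output
      alphabet has at least one letter.\<close>
    then have "ln (gallager_sum \<alpha> p W) \<le> ln CARD('y)"
      using * by (cases "gallager_sum \<alpha> p W = 0") auto
    then show "renyi_info \<alpha> p W \<le> \<alpha> / (\<alpha> - 1) * ln CARD('y)"
      using \<alpha>1 by (auto simp: renyi_info_def gallager_sum_def intro!: mult_left_mono divide_right_mono)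
  qed
qed

text \<open>A constant input conveys no information, and the capacity dominates this value.\<close>

lemma renyi_capacity_nonneg:
  fixes W :: "'x::finite \<Rightarrow> 'y::finite \<Rightarrow> real"
  assumes W: "discrete_channel W" and \<alpha>: "0 < \<alpha>" "\<alpha> \<noteq> 1"
  shows "0 \<le> renyi_capacity \<alpha> W"
proof -
  obtain x0 :: 'x where True by simp
  let ?p = "\<lambda>x::'x. if x = x0 then 1 else 0 :: real"
  have "(\<Sum>x\<in>UNIV. ?p x * W x y powr \<alpha>) = W x0 y powr \<alpha>" for y
    by (simp add: if_distrib[of "\<lambda>c. c * _"] cong: if_cong)
  then have "renyi_info \<alpha> ?p W = 0"
    using \<alpha> channel_nonneg[OF W] channel_sum[OF W] by (simp add: renyi_info_def powr_powr)
  then show ?thesis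
    unfolding renyi_capacity_def using bdd_above_renyi_info[OF assms] prob_dist_point
    by (metis cSUP_upper mem_Collect_eq)
qed

text \<open>Compactness of the probability simplex. It is placed in \<open>real^'x\<close>, where
  closed and bounded sets are compact.\<close>

lemma gallager_sum_minimizer:
  fixes W :: "'x::finite \<Rightarrow> 'y::finite \<Rightarrow> real"
  assumes W: "discrete_channel W" and \<alpha>: "0 < \<alpha>"
  obtains p where "prob_dist p" "\<And>p'. prob_dist p' \<Longrightarrow> gallager_sum \<alpha> p W \<le> gallager_sum \<alpha> p' W"
proof -
  define S where "S = {v :: real^'x. (\<forall>x. 0 \<le> v $ x) \<and> (\<Sum>x\<in>UNIV. v $ x) = 1}"
  define G where "G v = gallager_sum \<alpha> (\<lambda>x. v $ x) W" for v
  have "closed S"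
    unfolding S_def by (intro closed_Collect_conj closed_Collect_all closed_Collect_le closed_Collect_eq continuous_intros)
  moreover have "bounded S"
  proof (rule boundedI)
    fix v assume "v \<in> S"
    then have "(\<Sum>x\<in>UNIV. \<bar>v $ x\<bar>) = 1" by (simp add: S_def)
    then show "norm v \<le> 1" using norm_le_l1_cart[of v] by simp
  qed
  ultimately have "compact S" by (simp add: compact_eq_bounded_closed)
  moreover have "(\<chi> x::'x. 1 / real CARD('x)) \<in> S" by (simp add: S_def)
  then have "S \<noteq> {}" by blast
  moreover have "continuous_on S G"
    unfolding G_def gallager_sum_def using \<alpha>
    by (intro continuous_on_sum continuous_on_powr' continuous_intros)
       (auto simp: S_def intro!: sum_nonneg)
  ultimately obtain v where v: "v \<in> S" "\<forall>u\<in>S. G v \<le> G u"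
    using continuous_attains_inf[of S G] by blast
  show ?thesis
  proof
    show "prob_dist (\<lambda>x. v $ x)" using v(1) by (simp add: S_def prob_dist_def)
    fix p' :: "'x \<Rightarrow> real" assume "prob_dist p'"
    then have "(\<chi> x. p' x) \<in> S" by (simp add: S_def prob_dist_def)
    from v(2)[rule_format, OF this] show "gallager_sum \<alpha> (\<lambda>x. v $ x) W \<le> gallager_sum \<alpha> p' W"
      by (simp add: G_def)
  qed
qed

text \<open>First order optimality of p in the direction of the vertex x. Read with q proportional
  to the inner sum to the power 1 / \<alpha>, it says that the divergence of no row of W from q
  exceeds the capacity.\<close>

lemma gallager_sum_kkt:
  fixes W :: "'x::finite \<Rightarrow> 'y::finite \<Rightarrow> real"
  assumes W: "discrete_channel W" and \<alpha>: "0 < \<alpha>" "\<alpha> < 1" and p: "prob_dist p"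
    and min: "\<And>p'. prob_dist p' \<Longrightarrow> gallager_sum \<alpha> p W \<le> gallager_sum \<alpha> p' W"
  shows "gallager_sum \<alpha> p W \<le>
    (\<Sum>y\<in>UNIV. W x y powr \<alpha> * (\<Sum>x'\<in>UNIV. p x' * W x' y powr \<alpha>) powr (1 / \<alpha> - 1))"
proof -
  define g where "g y = (\<Sum>x\<in>UNIV. p x * W x y powr \<alpha>)" for y
  define r where "r = 1 / \<alpha>"
  have r: "1 < r" using \<alpha> by (simp add: r_def)
  define h where "h t y = (1 - t) * g y + t * W x y powr \<alpha>" for t y
  have g0: "0 \<le> g y" for y
    using p unfolding g_def by (intro sum_nonneg) (auto simp: prob_dist_def)
  have nonneg: "0 \<le> (\<Sum>y\<in>UNIV. h t y powr (r - 1) * (W x y powr \<alpha> - g y))" if t: "0 < t" "t \<le> 1" for t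
  proof -
    define p' where "p' x' = (1 - t) * p x' + t * (if x' = x then 1 else 0)" for x'
    have p': "prob_dist p'"
      using p t by (auto simp: prob_dist_def p'_def sum.distrib simp flip: sum_distrib_left)
    have "(\<Sum>x'\<in>UNIV. p' x' * W x' y powr \<alpha>) = h t y" for y
      by (simp add: p'_def h_def g_def distrib_right sum.distrib sum_distrib_left mult.assoc
            if_distrib[of "\<lambda>c. c * _"] if_distrib[of "\<lambda>c. _ * c"] cong: if_cong)
    then have "(\<Sum>y\<in>UNIV. g y powr r) \<le> (\<Sum>y\<in>UNIV. h t y powr r)"
      using min[OF p'] by (simp add: gallager_sum_def g_def r_def)
    then have "0 \<le> (\<Sum>y\<in>UNIV. h t y powr r - g y powr r)" by (simp add: sum_subtractf)
    also \<comment> \<open>The tangent is taken at the perturbed point, so that nothing is differentiated where \<open>g\<close> vanishes.\<close>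
    have "\<dots> \<le> (\<Sum>y\<in>UNIV. r * h t y powr (r - 1) * (h t y - g y))"
      using t g0 r by (intro sum_mono powr_tangent_le) (auto simp: h_def)
    also have "\<dots> = (r * t) * (\<Sum>y\<in>UNIV. h t y powr (r - 1) * (W x y powr \<alpha> - g y))"
      unfolding sum_distrib_left by (intro sum.cong) (auto simp: h_def algebra_simps)
    finally show ?thesis using r t mult_pos_pos[of r t] by (simp add: zero_le_mult_iff del: mult_pos_pos)
  qed
  \<comment> \<open>The step t shrinks to 0. As r - 1 > 0, the power is continuous even where
    \<open>g\<close> vanishes.\<close>
  have "((\<lambda>t. \<Sum>y\<in>UNIV. h t y powr (r - 1) * (W x y powr \<alpha> - g y)) \<longlongrightarrow>
      (\<Sum>y\<in>UNIV. h 0 y powr (r - 1) * (W x y powr \<alpha> - g y))) (at_right 0)"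
  proof (intro tendsto_sum tendsto_mult tendsto_const tendsto_powr2)
    fix y show "((\<lambda>t. h t y) \<longlongrightarrow> h 0 y) (at_right 0)"
      unfolding h_def by (intro tendsto_intros)
    show "\<forall>\<^sub>F t in at_right 0. 0 \<le> h t y"
      unfolding eventually_at_right_field using g0 by (intro exI[of _ 1]) (auto simp: h_def)
  qed (use r in auto)
  moreover have "\<forall>\<^sub>F t in at_right 0. 0 \<le> (\<Sum>y\<in>UNIV. h t y powr (r - 1) * (W x y powr \<alpha> - g y))"
    unfolding eventually_at_right_field using nonneg by (intro exI[of _ 1]) auto
  ultimately have "0 \<le> (\<Sum>y\<in>UNIV. h 0 y powr (r - 1) * (W x y powr \<alpha> - g y))"
    by (intro tendsto_lowerbound) auto
  also have "\<dots> = (\<Sum>y\<in>UNIV. W x y powr \<alpha> * g y powr (r - 1)) - (\<Sum>y\<in>UNIV. g y powr (r - 1) * g y)"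
    by (simp add: h_def algebra_simps sum_subtractf)
  also have "(\<Sum>y\<in>UNIV. g y powr (r - 1) * g y) = (\<Sum>y\<in>UNIV. g y powr r)"
  proof (intro sum.cong refl)
    fix y show "g y powr (r - 1) * g y = g y powr r"
      using g0[of y] by (cases "g y = 0") (auto simp: powr_diff)
  qed
  finally show ?thesis by (simp add: gallager_sum_def g_def r_def)
qed

text \<open>Renyi divergence from q does not decrease with the order: the summand of order \<alpha>
  is the geometric mean, with weights \<theta> and 1 - \<theta>, of the one of order \<beta> and of
  W, and W sums to 1.\<close>

lemma tilted_sum_mono_order:
  assumes W: "discrete_channel W" and q: "prob_dist q" and \<beta>: "0 < \<beta>" "\<beta> \<le> \<alpha>" "\<alpha> < 1"
    and le: "exp ((\<alpha> - 1) * c) \<le> (\<Sum>y\<in>UNIV. W x y powr \<alpha> * q y powr (1 - \<alpha>))"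
  shows "exp ((\<beta> - 1) * c) \<le> (\<Sum>y\<in>UNIV. W x y powr \<beta> * q y powr (1 - \<beta>))"
proof (cases "\<beta> = \<alpha>")
  case True then show ?thesis using le by simp
next
  case False
  define \<theta> where "\<theta> = (1 - \<alpha>) / (1 - \<beta>)"
  have \<theta>: "0 < \<theta>" "\<theta> < 1" using \<beta> False by (auto simp: \<theta>_def)
  have \<theta>': "(1 - \<beta>) * \<theta> = 1 - \<alpha>" using \<beta> by (simp add: \<theta>_def)
  then have \<theta>'': "\<beta> * \<theta> + (1 - \<theta>) = \<alpha>" by (simp add: algebra_simps)
  let ?s = "\<Sum>y\<in>UNIV. W x y powr \<beta> * q y powr (1 - \<beta>)"
  have q0: "0 \<le> q y" for y using q by (simp add: prob_dist_def)
  have "W x y powr \<alpha> * q y powr (1 - \<alpha>) = (W x y powr \<beta> * q y powr (1 - \<beta>)) powr \<theta> * W x y powr (1 - \<theta>)" for y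
  proof -
    have "W x y powr \<alpha> = W x y powr (\<beta> * \<theta>) * W x y powr (1 - \<theta>)"
      unfolding powr_add[symmetric] \<theta>'' ..
    then show ?thesis using channel_nonneg[OF W] q0 by (simp add: powr_mult powr_powr \<theta>')
  qed
  then have "exp ((\<alpha> - 1) * c) \<le> (\<Sum>y\<in>UNIV. (W x y powr \<beta> * q y powr (1 - \<beta>)) powr \<theta> * W x y powr (1 - \<theta>))"
    using le by simp
  also have "\<dots> \<le> ?s powr \<theta> * (\<Sum>y\<in>UNIV. W x y) powr (1 - \<theta>)"
    using \<theta> channel_nonneg[OF W] q0 by (intro Holder_sum_powr) auto
  also have "\<dots> = ?s powr \<theta>" using channel_sum[OF W] by simp
  finally have "exp ((\<alpha> - 1) * c) powr (1 / \<theta>) \<le> (?s powr \<theta>) powr (1 / \<theta>)"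
    using \<theta> by (intro powr_mono2) auto
  also have "(?s powr \<theta>) powr (1 / \<theta>) = ?s"
    using \<theta> by (simp add: powr_powr sum_nonneg)
  also have "exp ((\<alpha> - 1) * c) powr (1 / \<theta>) = exp ((\<beta> - 1) * c)"
  proof -
    have "(\<alpha> - 1) / \<theta> = \<beta> - 1" using \<theta>' \<theta> by (simp add: field_simps)
    then have "1 / \<theta> * ((\<alpha> - 1) * c) = (\<beta> - 1) * c"
      by (metis mult.assoc mult.commute mult.right_neutral times_divide_eq_right)
    then show ?thesis by (simp add: powr_def)
  qed
  finally show ?thesis .
qed

text \<open>The supremum defining the capacity is attained at the minimizing p, so \<open>F\<close>
  determines the capacity exactly, and \<open>gallager_sum_kkt\<close> becomes the minimax property
  of q at order \<alpha>. Smaller orders \<beta> are included, with the capacity still taken at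
  \<alpha>, so that one center can later serve a whole interval of orders.\<close>

lemma renyi_center:
  fixes W :: "'x::finite \<Rightarrow> 'y::finite \<Rightarrow> real"
  assumes W: "discrete_channel W" and \<alpha>: "0 < \<alpha>" "\<alpha> < 1"
  obtains q where "prob_dist q"
    "\<And>\<beta> x. 0 < \<beta> \<Longrightarrow> \<beta> \<le> \<alpha> \<Longrightarrow>
      exp ((\<beta> - 1) * renyi_capacity \<alpha> W) \<le> (\<Sum>y\<in>UNIV. W x y powr \<beta> * q y powr (1 - \<beta>))"
proof -
  obtain p where p: "prob_dist p" and min: "\<And>p'. prob_dist p' \<Longrightarrow> gallager_sum \<alpha> p W \<le> gallager_sum \<alpha> p' W"
    using gallager_sum_minimizer[OF W] \<alpha> by metis
  define F where "F = gallager_sum \<alpha> p W"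
  define g where "g y = (\<Sum>x\<in>UNIV. p x * W x y powr \<alpha>)" for y
  have F_eq: "F = (\<Sum>y\<in>UNIV. g y powr (1 / \<alpha>))" by (simp add: F_def gallager_sum_def g_def)
  have "F > 0"
    using gallager_sum_ge[OF W p uniform_prob_dist \<alpha> uniform_tilted_sum_ge[OF W \<alpha>]] 
    by (simp add: F_def powr_def) (meson exp_gt_zero less_le_trans)
  have g0: "0 \<le> g y" for y
    using p unfolding g_def by (intro sum_nonneg) (auto simp: prob_dist_def)
  have info: "renyi_info \<alpha> p' W \<le> \<alpha> / (\<alpha> - 1) * ln F" if "prob_dist p'" for p'
  proof -
    have "ln F \<le> ln (gallager_sum \<alpha> p' W)" using min[OF that] \<open>F > 0\<close> by (simp add: F_def)
    then have "\<alpha> / (\<alpha> - 1) * ln (gallager_sum \<alpha> p' W) \<le> \<alpha> / (\<alpha> - 1) * ln F"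
      using \<alpha> by (intro mult_left_mono_neg) (auto simp: divide_nonneg_nonpos)
    then show ?thesis using \<alpha> by (simp add: renyi_info_def gallager_sum_def)
  qed
  have cap: "renyi_capacity \<alpha> W = \<alpha> / (\<alpha> - 1) * ln F"
    unfolding renyi_capacity_def
  proof (rule cSup_eq_maximum)
    have "renyi_info \<alpha> p W = \<alpha> / (\<alpha> - 1) * ln F"
      using \<alpha> by (simp add: renyi_info_def F_def gallager_sum_def)
    then show "\<alpha> / (\<alpha> - 1) * ln F \<in> (\<lambda>p. renyi_info \<alpha> p W) ` {p. prob_dist p}" using p by force
  qed (use info in auto)
  define q where "q y = g y powr (1 / \<alpha>) / F" for y
  have q: "prob_dist q"
    using \<open>F > 0\<close> by (auto simp: prob_dist_def q_def F_eq simp flip: sum_divide_distrib)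
  have center: "exp ((\<alpha> - 1) * renyi_capacity \<alpha> W) \<le> (\<Sum>y\<in>UNIV. W x y powr \<alpha> * q y powr (1 - \<alpha>))" for x
  proof -
    have "exp ((\<alpha> - 1) * renyi_capacity \<alpha> W) = F powr \<alpha>"
      using \<alpha> \<open>F > 0\<close> by (simp add: cap powr_def)
    also have "\<dots> = F / F powr (1 - \<alpha>)" using \<open>F > 0\<close> by (simp add: powr_diff)
    also have "\<dots> \<le> (\<Sum>y\<in>UNIV. W x y powr \<alpha> * g y powr (1 / \<alpha> - 1)) / F powr (1 - \<alpha>)"
      using gallager_sum_kkt[OF W \<alpha> p min] by (intro divide_right_mono) (auto simp: F_def g_def)
    also have "\<dots> = (\<Sum>y\<in>UNIV. W x y powr \<alpha> * q y powr (1 - \<alpha>))"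
    proof -
      have "q y powr (1 - \<alpha>) = g y powr (1 / \<alpha> - 1) / F powr (1 - \<alpha>)" for y
      proof -
        have "1 / \<alpha> * (1 - \<alpha>) = 1 / \<alpha> - 1" using \<alpha> by (simp add: field_simps)
        then show ?thesis using \<open>F > 0\<close> by (simp add: q_def powr_divide powr_powr)
      qed
      then show ?thesis by (simp add: sum_divide_distrib)
    qed
    finally show ?thesis .
  qed
  show ?thesis using that[OF q] tilted_sum_mono_order[OF W q _ _ \<alpha>(2) center] by blast
qed

lemma renyi_capacity_mono:
  assumes W: "discrete_channel W" and "0 < \<beta>" "\<beta> \<le> \<alpha>" "\<alpha> < 1"
  shows "renyi_capacity \<beta> W \<le> renyi_capacity \<alpha> W"
proof -
  have "0 < \<alpha>" using assms by simp
  from renyi_center[OF W this \<open>\<alpha> < 1\<close>] obtain q where "prob_dist q"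
    "\<And>\<beta> x. 0 < \<beta> \<Longrightarrow> \<beta> \<le> \<alpha> \<Longrightarrow>
      exp ((\<beta> - 1) * renyi_capacity \<alpha> W) \<le> (\<Sum>y\<in>UNIV. W x y powr \<beta> * q y powr (1 - \<beta>))"
    by blast
  then show ?thesis using assms by (intro renyi_capacity_le[OF W]) auto
qed

text \<open>The point is that the supremum is finite. The factor (1 - \<alpha>) / \<alpha> blows up
  near 0, but R is at least the capacity of order \<open>\<alpha>0\<close>, which makes all terms of
  smaller order nonpositive. Orders above 1 contribute at most R, since capacities are
  nonnegative.\<close>

lemma sphere_packing_exp_ge:
  fixes W :: "'x::finite \<Rightarrow> 'y::finite \<Rightarrow> real"
  assumes W: "discrete_channel W" and \<alpha>0: "0 < \<alpha>0" "\<alpha>0 < 1" and R: "renyi_capacity \<alpha>0 W \<le> R" and "0 < \<alpha>"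
  shows "(1 - \<alpha>) / \<alpha> * (renyi_capacity \<alpha> W - R) \<le> sphere_packing_exp R W"
  unfolding sphere_packing_exp_def
proof (rule cSUP_upper)
  have R0: "0 \<le> R" using renyi_capacity_nonneg[OF W \<alpha>0(1)] \<alpha>0 R by simp
  have card: "0 \<le> ln (real CARD('y))" by simp
  show "bdd_above ((\<lambda>\<alpha>. (1 - \<alpha>) / \<alpha> * (renyi_capacity \<alpha> W - R)) ` {0<..})"
  proof (intro bdd_aboveI2)
    fix \<beta> :: real assume "\<beta> \<in> {0<..}"
    then have \<beta>: "0 < \<beta>" by simp
    consider "\<beta> \<le> \<alpha>0" | "\<alpha>0 < \<beta>" "\<beta> < 1" | "\<beta> = 1" | "1 < \<beta>" by linarith
    then show "(1 - \<beta>) / \<beta> * (renyi_capacity \<beta> W - R) \<le> 1 / \<alpha>0 * ln CARD('y) + R"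
    proof cases
      case 1
      then have "(1 - \<beta>) / \<beta> * (renyi_capacity \<beta> W - R) \<le> 0"
        using renyi_capacity_mono[OF W \<beta> 1] R \<alpha>0 \<beta> by (intro mult_nonneg_nonpos) auto
      also have "0 \<le> 1 / \<alpha>0 * ln CARD('y) + R" using R0 \<alpha>0 card by (intro add_nonneg_nonneg) auto
      finally show ?thesis .
    next
      case 2
      have "(1 - \<beta>) / \<beta> * (renyi_capacity \<beta> W - R) \<le> (1 - \<beta>) / \<beta> * ln CARD('y)"
        using renyi_capacity_le_ln_card[OF W \<beta>] 2 R0 \<beta> by (intro mult_left_mono) auto
      also have "\<dots> \<le> 1 / \<alpha>0 * ln CARD('y)"
        using 2 \<alpha>0 card by (intro mult_right_mono frac_le) auto
      finally show ?thesis using R0 by simp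
    next
      case 3
      then show ?thesis using R0 \<alpha>0 card by simp
    next
      case 4
      have "(1 - \<beta>) / \<beta> * (renyi_capacity \<beta> W - R) \<le> (1 - \<beta>) / \<beta> * (- R)"
        using renyi_capacity_nonneg[OF W \<beta>] 4 by (intro mult_left_mono_neg) (auto simp: divide_nonpos_nonneg)
      also have "\<dots> = (\<beta> - 1) / \<beta> * R" by (simp add: field_simps)
      also have "\<dots> \<le> 1 * R" using 4 R0 by (intro mult_right_mono) auto
      finally show ?thesis using \<alpha>0 card by (smt (verit) divide_nonneg_pos mult_nonneg_nonneg)
    qed
  qed
qed (use assms in auto)

lemma sphere_packing_exp_nonneg:
  assumes "discrete_channel W" "0 < \<alpha>0" "\<alpha>0 < 1" "renyi_capacity \<alpha>0 W \<le> R"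
  shows "0 \<le> sphere_packing_exp R W"
  using sphere_packing_exp_ge[OF assms, of 1] by simp

section \<open>Tilted distributions and output sequences\<close>

lemma Gibbs_inequality:
  fixes V P :: "'i \<Rightarrow> real"
  assumes "finite \<Omega>" "\<And>i. i \<in> \<Omega> \<Longrightarrow> 0 \<le> V i" "\<And>i. i \<in> \<Omega> \<Longrightarrow> 0 \<le> P i"
    and "\<And>i. i \<in> \<Omega> \<Longrightarrow> P i = 0 \<Longrightarrow> V i = 0" and "sum P \<Omega> \<le> sum V \<Omega>"
  shows "0 \<le> (\<Sum>i\<in>\<Omega>. V i * ln (V i / P i))"
proof -
  have "V i - P i \<le> V i * ln (V i / P i)" if i: "i \<in> \<Omega>" for i
  proof (cases "V i = 0")
    case True then show ?thesis using assms i by simp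
  next
    case False
    then have pos: "0 < V i" "0 < P i" using assms(2,3,4)[OF i] by (auto simp: less_le)
    then have "- ln (V i / P i) = ln (P i / V i)" by (simp add: ln_div)
    also have "\<dots> \<le> P i / V i - 1" using pos by (intro ln_le_minus_one) simp
    finally have "V i * (1 - P i / V i) \<le> V i * ln (V i / P i)"
      using pos by (intro mult_left_mono) auto
    moreover have "V i * (1 - P i / V i) = V i - P i" using pos by (simp add: field_simps)
    ultimately show ?thesis by simp
  qed
  then have "(\<Sum>i\<in>\<Omega>. V i - P i) \<le> (\<Sum>i\<in>\<Omega>. V i * ln (V i / P i))" by (rule sum_mono)
  then show ?thesis using assms(5) by (simp add: sum_subtractf)
qed

text \<open>Controls negative log-likelihood ratios: with u = V / q it gives V (ln u)^2 <= q,
  however large the logarithm is.\<close>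

lemma mult_ln_squared_le_1:
  fixes u :: real
  assumes "0 < u" "u \<le> 1"
  shows "u * (ln u)\<^sup>2 \<le> 1"
proof -
  define t where "t = - ln u / 2"
  have t: "0 \<le> t" using assms by (simp add: t_def)
  have "2 * t \<le> 1 + t + t\<^sup>2 / 2" using sum_power2_ge_zero[of "t - 1" 0] by (simp add: power2_eq_square algebra_simps)
  also have "\<dots> \<le> exp t" by (rule exp_lower_Taylor_quadratic[OF t])
  finally have "(2 * t)\<^sup>2 \<le> (exp t)\<^sup>2" using t by (intro power_mono) auto
  moreover have "(exp t)\<^sup>2 = 1 / u"
    using assms by (simp add: t_def power2_eq_square exp_minus inverse_eq_divide flip: exp_add)
  ultimately have "(ln u)\<^sup>2 \<le> 1 / u" by (simp add: t_def)
  then show ?thesis using assms by (simp add: pos_le_divide_eq mult.commute)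
qed

text \<open>Second order expansion of exp (s ln (V / q)), whose linear term is the divergence. The
  log ratio is bounded above by c but not below; its positive part has second moment at most c^2,
  its negative part at most \<open>sum q \<Omega>\<close> by \<open>mult_ln_squared_le_1\<close>.
  Hence c^2 + 1.\<close>

lemma likelihood_ratio_moment_le:
  fixes V q :: "'i \<Rightarrow> real"
  assumes fin: "finite \<Omega>" and V0: "\<And>i. i \<in> \<Omega> \<Longrightarrow> 0 \<le> V i" and q0: "\<And>i. i \<in> \<Omega> \<Longrightarrow> 0 \<le> q i"
    and ac: "\<And>i. i \<in> \<Omega> \<Longrightarrow> q i = 0 \<Longrightarrow> V i = 0" and V1: "sum V \<Omega> = 1" and q1: "sum q \<Omega> \<le> 1"
    and D: "(\<Sum>i\<in>\<Omega>. V i * ln (V i / q i)) \<le> D"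
    and c: "\<And>i. i \<in> \<Omega> \<Longrightarrow> 0 < V i \<Longrightarrow> ln (V i / q i) \<le> c" and s: "0 \<le> s" "s * c \<le> 1" "0 \<le> c"
  shows "(\<Sum>i\<in>\<Omega>. V i * (V i / q i) powr s) \<le> exp (s * D + s\<^sup>2 * (c\<^sup>2 + 1))"
proof -
  have le: "V i * (V i / q i) powr s \<le> V i + s * (V i * ln (V i / q i)) + s\<^sup>2 * (c\<^sup>2 * V i + q i)"
    if i: "i \<in> \<Omega>" for i
  proof (cases "V i = 0")
    case True then show ?thesis using q0[OF i] by simp
  next
    case False
    then have pos: "0 < V i" "0 < q i" using V0[OF i] q0[OF i] ac[OF i] by (auto simp: less_le)
    define x where "x = ln (V i / q i)"
    have "x \<le> c" using c[OF i] pos by (simp add: x_def)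
    then have "s * x \<le> 1" using mult_left_mono[of x c s] s by linarith
    have "exp (s * x) \<le> 1 + s * x + (s * x)\<^sup>2"
    proof (cases "0 \<le> s * x")
      case True
      then show ?thesis using \<open>s * x \<le> 1\<close> by (rule exp_bound)
    next
      case False
      define z where "z = - (s * x)"
      have z: "0 < z" using False by (simp add: z_def)
      \<comment> \<open>The product is 1 + z^3.\<close>
      have "1 \<le> (1 - z + z\<^sup>2) * (1 + z)"
        using z by (simp add: power2_eq_square algebra_simps)
      also have "\<dots> \<le> (1 - z + z\<^sup>2) * exp z"
      proof (intro mult_left_mono)
        show "0 \<le> 1 - z + z\<^sup>2"
          using sum_power2_ge_zero[of "z - 1/2" 0] by (simp add: power2_eq_square algebra_simps)
      qed simp
      finally have "exp (- z) \<le> 1 - z + z\<^sup>2" by (simp add: exp_minus field_simps)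
      then show ?thesis by (simp add: z_def)
    qed
    moreover have "V i * x\<^sup>2 \<le> c\<^sup>2 * V i + q i"
    proof (cases "0 \<le> x")
      case True
      then have "x\<^sup>2 \<le> c\<^sup>2" using \<open>x \<le> c\<close> by (intro power_mono)
      then have "V i * x\<^sup>2 \<le> V i * c\<^sup>2" using pos by (intro mult_left_mono) auto
      also have "\<dots> \<le> c\<^sup>2 * V i + q i" using pos by (simp add: mult.commute)
      finally show ?thesis .
    next
      case False
      then have "V i / q i \<le> 1" using pos ln_ge_zero[of "V i / q i"] by (force simp: x_def)
      then have "(V i / q i) * x\<^sup>2 \<le> 1"
        using mult_ln_squared_le_1[of "V i / q i"] pos by (simp add: x_def)
      then have "V i * x\<^sup>2 \<le> q i" using pos by (simp add: field_simps)
      then show ?thesis using pos by (smt (verit) mult_nonneg_nonneg zero_le_power2)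
    qed
    then have "s\<^sup>2 * (V i * x\<^sup>2) \<le> s\<^sup>2 * (c\<^sup>2 * V i + q i)" by (intro mult_left_mono) auto
    moreover have "(V i / q i) powr s = exp (s * x)" using pos by (simp add: powr_def x_def)
    moreover have "V i * exp (s * x) \<le> V i * (1 + s * x + (s * x)\<^sup>2)"
      using pos calculation(1) by (intro mult_left_mono) auto
    ultimately show ?thesis by (simp add: x_def algebra_simps power_mult_distrib)
  qed
  have "(\<Sum>i\<in>\<Omega>. V i * (V i / q i) powr s)
      \<le> (\<Sum>i\<in>\<Omega>. V i + s * (V i * ln (V i / q i)) + s\<^sup>2 * (c\<^sup>2 * V i + q i))"
    by (intro sum_mono le)
  also have "\<dots> = 1 + s * (\<Sum>i\<in>\<Omega>. V i * ln (V i / q i)) + s\<^sup>2 * (c\<^sup>2 + sum q \<Omega>)"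
    using V1 by (simp add: sum.distrib flip: sum_distrib_left)
  also have "\<dots> \<le> 1 + (s * D + s\<^sup>2 * (c\<^sup>2 + 1))"
    using D q1 s by (simp add: mult_left_mono add_mono)
  also have "\<dots> \<le> exp (s * D + s\<^sup>2 * (c\<^sup>2 + 1))" by (rule exp_ge_add_one_self)
  finally show ?thesis .
qed

text \<open>The tilted law satisfies \<alpha> D(V||P) + (1 - \<alpha>) D(V||q) = - ln Z(\<alpha>),
  so an upper bound on - ln Z, which is what a Renyi center provides, bounds one divergence once the
  other is known. At \<open>\<alpha>0\<close> it gives D(V||q) <= \<rho>. If this still holds at
  \<open>\<alpha>1\<close>, then \<open>high\<close> bounds D(V||P) there; otherwise D(V||q) =
  \<rho> at some order in between, where \<open>mid\<close> applies.\<close>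

lemma tilted_distribution:
  fixes P q :: "'i \<Rightarrow> real" and \<alpha>0 \<alpha>1 \<rho> \<delta> :: real
  assumes fin: "finite \<Omega>" and P0: "\<And>i. i \<in> \<Omega> \<Longrightarrow> 0 \<le> P i" and q0: "\<And>i. i \<in> \<Omega> \<Longrightarrow> 0 < q i"
    and P1: "sum P \<Omega> = 1" and q1: "sum q \<Omega> = 1" and \<alpha>: "0 < \<alpha>0" "\<alpha>0 \<le> \<alpha>1" "\<alpha>1 < 1"
  defines "Z \<equiv> \<lambda>\<alpha>. \<Sum>i\<in>\<Omega>. P i powr \<alpha> * q i powr (1 - \<alpha>)"
  assumes low: "- ln (Z \<alpha>0) \<le> (1 - \<alpha>0) * \<rho>"
    and mid: "\<And>\<alpha>. \<alpha>0 \<le> \<alpha> \<Longrightarrow> \<alpha> \<le> \<alpha>1 \<Longrightarrow> - ln (Z \<alpha>) - (1 - \<alpha>) * \<rho> \<le> \<alpha> * \<delta>"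
    and high: "- ln (Z \<alpha>1) \<le> \<alpha>1 * \<delta>"
  obtains V where "\<And>i. i \<in> \<Omega> \<Longrightarrow> 0 \<le> V i" "sum V \<Omega> = 1" "\<And>i. i \<in> \<Omega> \<Longrightarrow> P i = 0 \<Longrightarrow> V i = 0"
    "(\<Sum>i\<in>\<Omega>. V i * ln (V i / q i)) \<le> \<rho>" "(\<Sum>i\<in>\<Omega>. V i * ln (V i / P i)) \<le> \<delta>"
proof -
  define V where "V \<alpha> i = P i powr \<alpha> * q i powr (1 - \<alpha>) / Z \<alpha>" for \<alpha> i
  have Zpos: "0 < Z \<alpha>" for \<alpha>
  proof -
    obtain i where i: "i \<in> \<Omega>" "P i \<noteq> 0"
      using P1 by (metis sum.neutral zero_neq_one)
    then have "0 < P i powr \<alpha> * q i powr (1 - \<alpha>)" using q0 P0 by (auto simp: less_le)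
    then show ?thesis unfolding Z_def using i fin by (intro sum_pos2[of _ i]) auto
  qed
  have V0: "0 \<le> V \<alpha> i" for \<alpha> i using Zpos[of \<alpha>] by (simp add: V_def)
  have V1: "sum (V \<alpha>) \<Omega> = 1" for \<alpha>
    using Zpos[of \<alpha>] by (simp add: V_def Z_def flip: sum_divide_distrib)
  have VP: "P i = 0 \<Longrightarrow> V \<alpha> i = 0" for \<alpha> i by (simp add: V_def)
  define Dq where "Dq \<alpha> = (\<Sum>i\<in>\<Omega>. V \<alpha> i * ln (V \<alpha> i / q i))" for \<alpha>
  define DP where "DP \<alpha> = (\<Sum>i\<in>\<Omega>. V \<alpha> i * ln (V \<alpha> i / P i))" for \<alpha>
  have lnV: "ln (V \<alpha> i) = \<alpha> * ln (P i) + (1 - \<alpha>) * ln (q i) - ln (Z \<alpha>)" if "i \<in> \<Omega>" "P i \<noteq> 0" for \<alpha> i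
    using that P0[of i] q0[of i] Zpos[of \<alpha>] by (simp add: V_def ln_div ln_mult ln_powr)
  have Vpos: "0 < V \<alpha> i" if "i \<in> \<Omega>" "P i \<noteq> 0" for \<alpha> i
    using that P0[of i] q0[of i] Zpos[of \<alpha>] by (simp add: V_def)
  have key: "\<alpha> * DP \<alpha> + (1 - \<alpha>) * Dq \<alpha> = - ln (Z \<alpha>)" for \<alpha>
  proof -
    have "\<alpha> * (V \<alpha> i * ln (V \<alpha> i / P i)) + (1 - \<alpha>) * (V \<alpha> i * ln (V \<alpha> i / q i)) = V \<alpha> i * (- ln (Z \<alpha>))"
      if i: "i \<in> \<Omega>" for i
    proof (cases "P i = 0")
      case True then show ?thesis by (simp add: VP)
    next
      case False
      have "ln (V \<alpha> i / P i) = ln (V \<alpha> i) - ln (P i)" "ln (V \<alpha> i / q i) = ln (V \<alpha> i) - ln (q i)"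
        using Vpos[OF i False, of \<alpha>] P0[OF i] q0[OF i] False by (simp_all add: ln_div)
      then have "\<alpha> * ln (V \<alpha> i / P i) + (1 - \<alpha>) * ln (V \<alpha> i / q i) = - ln (Z \<alpha>)"
        by (simp only: lnV[OF i False]) (simp add: algebra_simps)
      then show ?thesis by (metis (no_types, lifting) distrib_left mult.left_commute)
    qed
    then have "\<alpha> * DP \<alpha> + (1 - \<alpha>) * Dq \<alpha> = (\<Sum>i\<in>\<Omega>. V \<alpha> i * (- ln (Z \<alpha>)))"
      unfolding DP_def Dq_def sum_distrib_left sum.distrib[symmetric] by (intro sum.cong) auto
    then show ?thesis by (simp only: V1 flip: sum_distrib_right)
  qed
  have DP0: "0 \<le> DP \<alpha>" for \<alpha>
    unfolding DP_def using P0 V0 VP P1 V1[of \<alpha>] by (intro Gibbs_inequality fin) auto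
  have Dq0: "0 \<le> Dq \<alpha>" for \<alpha>
    unfolding Dq_def using q0 V0 q1 V1[of \<alpha>] by (intro Gibbs_inequality fin) (auto simp: less_le)
  have cont: "continuous_on {\<alpha>0..\<alpha>1} Dq"
  proof -
    have "continuous_on {\<alpha>0..\<alpha>1} (\<lambda>\<alpha>. V \<alpha> i * ln (V \<alpha> i / q i))" if i: "i \<in> \<Omega>" for i
    proof (cases "P i = 0")
      case True
      then show ?thesis by (simp add: VP)
    next
      case False
      have Pi: "0 < P i" using P0[OF i] False by simp
      have cZ: "continuous_on {\<alpha>0..\<alpha>1} Z"
        unfolding Z_def
      proof (intro continuous_on_sum)
        fix j assume j: "j \<in> \<Omega>"
        \<comment> \<open>A power with positive base is continuous in the exponent; with base 0 it
          is constantly 0.\<close>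
        show "continuous_on {\<alpha>0..\<alpha>1} (\<lambda>\<alpha>. P j powr \<alpha> * q j powr (1 - \<alpha>))"
          using q0[OF j] by (cases "P j = 0") (auto intro!: continuous_intros)
      qed
      have cV: "continuous_on {\<alpha>0..\<alpha>1} (\<lambda>\<alpha>. V \<alpha> i)"
        unfolding V_def using cZ Zpos Pi q0[OF i] less_irrefl
        by (intro continuous_intros) (auto, (metis less_irrefl)+)
      show ?thesis using cV q0[OF i] Vpos[OF i False]
        by (intro continuous_intros cV) (auto, (metis less_irrefl)+)
    qed
    then show ?thesis unfolding Dq_def by (intro continuous_on_sum)
  qed
  have start: "Dq \<alpha>0 \<le> \<rho>"
  proof -
    have "(1 - \<alpha>0) * Dq \<alpha>0 \<le> (1 - \<alpha>0) * \<rho>"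
      using key[of \<alpha>0] DP0[of \<alpha>0] \<alpha> low by (smt (verit) mult_nonneg_nonneg)
    then show ?thesis using \<alpha> by simp
  qed
  have "\<exists>\<alpha>\<in>{\<alpha>0..\<alpha>1}. Dq \<alpha> \<le> \<rho> \<and> DP \<alpha> \<le> \<delta>"
  proof (cases "Dq \<alpha>1 \<le> \<rho>")
    case True
    have "\<alpha>1 * DP \<alpha>1 \<le> \<alpha>1 * \<delta>"
      using key[of \<alpha>1] Dq0[of \<alpha>1] \<alpha> high by (smt (verit) mult_nonneg_nonneg)
    then show ?thesis using True \<alpha> by (intro bexI[of _ \<alpha>1]) auto
  next
    case False
    then obtain \<alpha> where a: "\<alpha>0 \<le> \<alpha>" "\<alpha> \<le> \<alpha>1" "Dq \<alpha> = \<rho>"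
      using IVT'[of Dq \<alpha>0 \<rho> \<alpha>1] start cont \<alpha> by auto
    have "\<alpha> * DP \<alpha> \<le> \<alpha> * \<delta>" using key[of \<alpha>] mid[OF a(1,2)] a(3) by simp
    then show ?thesis using a \<alpha> by (intro bexI[of _ \<alpha>]) auto
  qed
  then obtain \<alpha> where "Dq \<alpha> \<le> \<rho>" "DP \<alpha> \<le> \<delta>" by blast
  then show ?thesis using that[of "V \<alpha>"] V0 V1 VP by (simp add: Dq_def DP_def)
qed

section \<open>Output sequences and the law of the feedback channel\<close>

lemma finite_feedback_outputs [simp]: "finite (feedback_outputs n :: 'y::finite list set)"
  using finite_lists_length_eq[of "UNIV :: 'y set" n] by (simp add: feedback_outputs_def)

lemma sum_feedback_outputs_append:
  fixes g :: "'y::finite list \<Rightarrow> real"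
  shows "(\<Sum>ys\<in>feedback_outputs (n + m). g ys)
       = (\<Sum>us\<in>feedback_outputs n. \<Sum>vs\<in>feedback_outputs m. g (us @ vs))"
proof -
  have "feedback_outputs (n + m) = (\<lambda>(us, vs). us @ vs) ` (feedback_outputs n \<times> feedback_outputs m :: ('y list \<times> 'y list) set)"
  proof (intro equalityI subsetI)
    fix ys :: "'y list" assume "ys \<in> feedback_outputs (n + m)"
    then show "ys \<in> (\<lambda>(us, vs). us @ vs) ` (feedback_outputs n \<times> feedback_outputs m)"
      by (intro image_eqI[of _ _ "(take n ys, drop n ys)"]) (auto simp: feedback_outputs_def)
  qed (auto simp: feedback_outputs_def)
  moreover have "inj_on (\<lambda>(us, vs). us @ vs) (feedback_outputs n \<times> feedback_outputs m :: ('y list \<times> 'y list) set)"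
    by (auto simp: inj_on_def feedback_outputs_def)
  ultimately show ?thesis
    by (simp add: sum.reindex sum.cartesian_product) (simp add: case_prod_beta)
qed

text \<open>After the outputs \<open>us\<close> the rest of the transmission is again a feedback
  channel, with encoding \<open>\<lambda>z. e (us @ z)\<close>. All arguments on blocks rest on
  this.\<close>

lemma feedback_prob_append:
  assumes "length us = n"
  shows "feedback_prob W (n + m) e (us @ vs) = feedback_prob W n e us * feedback_prob W m (\<lambda>z. e (us @ z)) vs"
proof -
  have "feedback_prob W (n + m) e (us @ vs) =
      (\<Prod>t<n. W (e (take t (us @ vs))) ((us @ vs) ! t)) * (\<Prod>t\<in>{n..<n + m}. W (e (take t (us @ vs))) ((us @ vs) ! t))"
    unfolding feedback_prob_def by (subst prod.union_disjoint[symmetric]) (auto intro!: prod.cong)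
  also have "(\<Prod>t<n. W (e (take t (us @ vs))) ((us @ vs) ! t)) = feedback_prob W n e us"
    unfolding feedback_prob_def using assms by (intro prod.cong) (auto simp: nth_append)
  also have "(\<Prod>t\<in>{n..<n + m}. W (e (take t (us @ vs))) ((us @ vs) ! t)) = feedback_prob W m (\<lambda>z. e (us @ z)) vs"
    unfolding feedback_prob_def using assms
    by (intro prod.reindex_bij_witness[of _ "\<lambda>t. t + n" "\<lambda>t. t - n"]) (auto simp: nth_append)
  finally show ?thesis .
qed

lemma feedback_outputs_0 [simp]: "feedback_outputs 0 = {[]}"
  by (auto simp: feedback_outputs_def)

lemma sum_feedback_outputs_1: "(\<Sum>ys\<in>feedback_outputs (Suc 0). g ys) = (\<Sum>y\<in>(UNIV::'y::finite set). g [y])"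
  by (intro sum.reindex_bij_witness[of _ "\<lambda>y. [y]" hd]) (auto simp: feedback_outputs_def length_Suc_conv)

lemma feedback_prob_1: "feedback_prob W (Suc 0) e [y] = W (e []) y"
  by (simp add: feedback_prob_def)

lemma feedback_prob_nonneg: "(\<And>x y. 0 \<le> W x y) \<Longrightarrow> 0 \<le> feedback_prob W n e ys"
  unfolding feedback_prob_def by (intro prod_nonneg) auto

text \<open>The first letter is split off rather than the last; what remains has a shifted encoding,
  hence the generalization over \<open>e\<close>.\<close>

lemma sum_feedback_prob:
  assumes W: "discrete_channel W"
  shows "(\<Sum>ys\<in>feedback_outputs n. feedback_prob W n e ys) = 1"
proof (induction n arbitrary: e)
  case 0
  then show ?case by (simp add: feedback_prob_def)
next
  case (Suc n)
  have "(\<Sum>ys\<in>feedback_outputs (Suc 0 + n). feedback_prob W (Suc 0 + n) e ys)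
      = (\<Sum>us\<in>feedback_outputs (Suc 0). \<Sum>vs\<in>feedback_outputs n.
           feedback_prob W (Suc 0) e us * feedback_prob W n (\<lambda>z. e (us @ z)) vs)"
    unfolding sum_feedback_outputs_append
    by (intro sum.cong refl feedback_prob_append) (simp add: feedback_outputs_def)
  also have "\<dots> = 1"
    using Suc.IH channel_sum[OF W]
    by (simp add: sum_feedback_outputs_1 feedback_prob_1 flip: sum_distrib_left)
  finally show ?case by simp
qed

text \<open>The product measure on output sequences is the law of the output of the feedback channel
  whose component ignores its input.\<close>

abbreviation product_prob :: "nat \<Rightarrow> ('y \<Rightarrow> real) \<Rightarrow> 'y list \<Rightarrow> real" where
  "product_prob n q \<equiv> feedback_prob (\<lambda>_::unit. q) n (\<lambda>_. ())"

text \<open>Feedback brings no gain here: the bound holds for every input letter, so choosing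
  letters according to past outputs cannot push the sum below the product of the bounds.\<close>

lemma feedback_tilted_sum_ge:
  fixes W :: "'x::finite \<Rightarrow> 'y::finite \<Rightarrow> real"
  assumes W: "discrete_channel W" and q: "prob_dist q" and "0 \<le> B"
    and le: "\<And>x. B \<le> (\<Sum>y\<in>UNIV. W x y powr \<alpha> * q y powr \<beta>)"
  shows "B ^ n \<le> (\<Sum>ys\<in>feedback_outputs n. feedback_prob W n e ys powr \<alpha> * product_prob n q ys powr \<beta>)"
proof (induction n arbitrary: e)
  case 0
  then show ?case by (simp add: feedback_prob_def)
next
  case (Suc n)
  have W0: "0 \<le> feedback_prob W k e' ys" for k e' ys
    using channel_nonneg[OF W] by (rule feedback_prob_nonneg)
  have q0: "0 \<le> product_prob k q ys" for k ys
    using q by (intro feedback_prob_nonneg) (auto simp: prob_dist_def)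
  have "B ^ Suc n \<le> (\<Sum>y\<in>UNIV. W (e []) y powr \<alpha> * q y powr \<beta>) * B ^ n"
    using le \<open>0 \<le> B\<close> by (simp add: mult_right_mono)
  also have "\<dots> \<le> (\<Sum>y\<in>UNIV. W (e []) y powr \<alpha> * q y powr \<beta> *
      (\<Sum>vs\<in>feedback_outputs n. feedback_prob W n (\<lambda>z. e ([y] @ z)) vs powr \<alpha> * product_prob n q vs powr \<beta>))"
    unfolding sum_distrib_right by (intro sum_mono mult_left_mono Suc.IH) auto
  also have "\<dots> = (\<Sum>us\<in>feedback_outputs (Suc 0). \<Sum>vs\<in>feedback_outputs n.
           (feedback_prob W (Suc 0) e us * feedback_prob W n (\<lambda>z. e (us @ z)) vs) powr \<alpha> *
           (product_prob (Suc 0) q us * product_prob n q vs) powr \<beta>)"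
    using W0 q0 channel_nonneg[OF W] q
    by (simp add: sum_feedback_outputs_1 feedback_prob_1 powr_mult sum_distrib_left prob_dist_def mult_ac)
  also have "\<dots> = (\<Sum>ys\<in>feedback_outputs (Suc 0 + n).
      feedback_prob W (Suc 0 + n) e ys powr \<alpha> * product_prob (Suc 0 + n) q ys powr \<beta>)"
    unfolding sum_feedback_outputs_append
    by (intro sum.cong refl) (simp only: feedback_prob_append feedback_outputs_def mem_Collect_eq)
  finally show ?case by simp
qed

section \<open>Composition of blocks\<close>

text \<open>The reference \<open>Q\<close> is chosen before the encoding function \<open>e\<close>, hence common to all messages.\<close>

definition moment_bound :: "('x::finite \<Rightarrow> 'y::finite \<Rightarrow> real) \<Rightarrow> nat \<Rightarrow> real \<Rightarrow> real \<Rightarrow> real \<Rightarrow> bool" where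
  "moment_bound W n s b d \<longleftrightarrow>
    (\<exists>Q V. (\<forall>ys\<in>feedback_outputs n. 0 < Q ys) \<and> (\<Sum>ys\<in>feedback_outputs n. Q ys) = 1 \<and>
      (\<forall>e. (\<forall>ys\<in>feedback_outputs n. 0 \<le> V e ys) \<and> (\<Sum>ys\<in>feedback_outputs n. V e ys) = 1 \<and>
        (\<forall>ys\<in>feedback_outputs n. feedback_prob W n e ys = 0 \<longrightarrow> V e ys = 0) \<and>
        (\<Sum>ys\<in>feedback_outputs n. V e ys * (V e ys / Q ys) powr s) \<le> exp b \<and>
        (\<Sum>ys\<in>feedback_outputs n. V e ys * (V e ys / feedback_prob W n e ys) powr s) \<le> exp d))"

lemma moment_boundE:
  assumes "moment_bound W n s b d"
  obtains Q V where "\<And>ys. ys \<in> feedback_outputs n \<Longrightarrow> 0 < Q ys" "(\<Sum>ys\<in>feedback_outputs n. Q ys) = 1"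
    "\<And>e ys. ys \<in> feedback_outputs n \<Longrightarrow> 0 \<le> V e ys" "\<And>e. (\<Sum>ys\<in>feedback_outputs n. V e ys) = 1"
    "\<And>e ys. ys \<in> feedback_outputs n \<Longrightarrow> feedback_prob W n e ys = 0 \<Longrightarrow> V e ys = 0"
    "\<And>e. (\<Sum>ys\<in>feedback_outputs n. V e ys * (V e ys / Q ys) powr s) \<le> exp b"
    "\<And>e. (\<Sum>ys\<in>feedback_outputs n. V e ys * (V e ys / feedback_prob W n e ys) powr s) \<le> exp d"
  using assms unfolding moment_bound_def by blast

lemma powr_mult_quotients:
  fixes a b c d s :: real
  assumes "0 \<le> a / b" "0 \<le> c / d"
  shows "(a * c / (b * d)) powr s = (a / b) powr s * (c / d) powr s"
  using assms by (simp only: powr_mult flip: times_divide_times_eq)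

text \<open>The bounds for the second block hold for every encoding, hence after every past, and can
  be pulled out of the sum over the first block.\<close>

lemma moment_bound_add:
  fixes W :: "'x::finite \<Rightarrow> 'y::finite \<Rightarrow> real"
  assumes W: "discrete_channel W" and 1: "moment_bound W n s b1 d1" and 2: "moment_bound W m s b2 d2"
  shows "moment_bound W (n + m) s (b1 + b2) (d1 + d2)"
proof -
  let ?F = "feedback_outputs :: nat \<Rightarrow> 'y list set"
  obtain Q1 V1 where Q1: "\<And>ys. ys \<in> ?F n \<Longrightarrow> 0 < Q1 ys" "(\<Sum>ys\<in>?F n. Q1 ys) = 1"
    and V1: "\<And>e ys. ys \<in> ?F n \<Longrightarrow> 0 \<le> V1 e ys" "\<And>e. (\<Sum>ys\<in>?F n. V1 e ys) = 1"
      "\<And>e ys. ys \<in> ?F n \<Longrightarrow> feedback_prob W n e ys = 0 \<Longrightarrow> V1 e ys = 0"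
    and b1: "\<And>e. (\<Sum>ys\<in>?F n. V1 e ys * (V1 e ys / Q1 ys) powr s) \<le> exp b1"
    and d1: "\<And>e. (\<Sum>ys\<in>?F n. V1 e ys * (V1 e ys / feedback_prob W n e ys) powr s) \<le> exp d1"
    using moment_boundE[OF 1] by blast
  obtain Q2 V2 where Q2: "\<And>ys. ys \<in> ?F m \<Longrightarrow> 0 < Q2 ys" "(\<Sum>ys\<in>?F m. Q2 ys) = 1"
    and V2: "\<And>e ys. ys \<in> ?F m \<Longrightarrow> 0 \<le> V2 e ys" "\<And>e. (\<Sum>ys\<in>?F m. V2 e ys) = 1"
      "\<And>e ys. ys \<in> ?F m \<Longrightarrow> feedback_prob W m e ys = 0 \<Longrightarrow> V2 e ys = 0"
    and b2: "\<And>e. (\<Sum>ys\<in>?F m. V2 e ys * (V2 e ys / Q2 ys) powr s) \<le> exp b2"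
    and d2: "\<And>e. (\<Sum>ys\<in>?F m. V2 e ys * (V2 e ys / feedback_prob W m e ys) powr s) \<le> exp d2"
    using moment_boundE[OF 2] by blast
  define Q where "Q ys = Q1 (take n ys) * Q2 (drop n ys)" for ys
  \<comment> \<open>The second factor belongs to the encoding that remains after the first block; in
    this way the tilting follows the past, while \<open>Q\<close> stays a fixed product.\<close>
  define V where "V e ys = V1 e (take n ys) * V2 (\<lambda>z. e (take n ys @ z)) (drop n ys)" for e ys
  have W0: "0 \<le> feedback_prob W k e' ys" for k e' ys
    using channel_nonneg[OF W] by (rule feedback_prob_nonneg)
  have split: "take n ys \<in> ?F n" "drop n ys \<in> ?F m" if "ys \<in> ?F (n + m)" for ys
    using that by (auto simp: feedback_outputs_def)
  have product_le: "(\<Sum>us\<in>?F n. \<Sum>vs\<in>?F m. f us * g us vs) \<le> exp (x + y)"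
    if "\<And>us. us \<in> ?F n \<Longrightarrow> 0 \<le> f us" "(\<Sum>us\<in>?F n. f us) \<le> exp x"
      "\<And>us. (\<Sum>vs\<in>?F m. g us vs) \<le> exp y" for f g and x y :: real
  proof -
    have "(\<Sum>us\<in>?F n. \<Sum>vs\<in>?F m. f us * g us vs) \<le> (\<Sum>us\<in>?F n. f us * exp y)"
      unfolding sum_distrib_left[symmetric] using that by (intro sum_mono mult_left_mono) auto
    also have "\<dots> \<le> exp x * exp y"
      unfolding sum_distrib_right[symmetric] using that by (intro mult_right_mono) auto
    finally show ?thesis by (simp add: exp_add)
  qed
  have "(\<Sum>ys\<in>?F (n + m). Q ys) = (\<Sum>us\<in>?F n. \<Sum>vs\<in>?F m. Q1 us * Q2 vs)"
    unfolding sum_feedback_outputs_append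
    by (intro sum.cong refl) (auto simp: Q_def feedback_outputs_def)
  then have Qsum: "(\<Sum>ys\<in>?F (n + m). Q ys) = 1"
    using Q1(2) Q2(2) by (simp flip: sum_distrib_left sum_distrib_right)
  have "(\<forall>ys\<in>?F (n + m). 0 \<le> V e ys) \<and> (\<Sum>ys\<in>?F (n + m). V e ys) = 1 \<and>
        (\<forall>ys\<in>?F (n + m). feedback_prob W (n + m) e ys = 0 \<longrightarrow> V e ys = 0) \<and>
        (\<Sum>ys\<in>?F (n + m). V e ys * (V e ys / Q ys) powr s) \<le> exp (b1 + b2) \<and>
        (\<Sum>ys\<in>?F (n + m). V e ys * (V e ys / feedback_prob W (n + m) e ys) powr s) \<le> exp (d1 + d2)" for e
  proof (intro conjI ballI impI)
    fix ys assume ys: "ys \<in> ?F (n + m)"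
    show "0 \<le> V e ys" using V1(1) V2(1) split[OF ys] by (simp add: V_def)
    assume "feedback_prob W (n + m) e ys = 0"
    then have "feedback_prob W n e (take n ys) * feedback_prob W m (\<lambda>z. e (take n ys @ z)) (drop n ys) = 0"
      using feedback_prob_append[of "take n ys" n W m e "drop n ys"] split[OF ys]
      by (simp add: feedback_outputs_def)
    then show "V e ys = 0" using V1(3) V2(3) split[OF ys] by (auto simp: V_def)
  next
    have "(\<Sum>ys\<in>?F (n + m). V e ys) = (\<Sum>us\<in>?F n. \<Sum>vs\<in>?F m. V1 e us * V2 (\<lambda>z. e (us @ z)) vs)"
      unfolding sum_feedback_outputs_append
      by (intro sum.cong refl) (auto simp: V_def feedback_outputs_def)
    then show "(\<Sum>ys\<in>?F (n + m). V e ys) = 1"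
      using V1(2) V2(2) by (simp flip: sum_distrib_left)
  next
    have "(\<Sum>ys\<in>?F (n + m). V e ys * (V e ys / Q ys) powr s) =
       (\<Sum>us\<in>?F n. \<Sum>vs\<in>?F m. (V1 e us * (V1 e us / Q1 us) powr s) *
         (V2 (\<lambda>z. e (us @ z)) vs * (V2 (\<lambda>z. e (us @ z)) vs / Q2 vs) powr s))"
      unfolding sum_feedback_outputs_append
    proof (intro sum.cong refl)
      fix us vs assume us: "us \<in> ?F n" and vs: "vs \<in> ?F m"
      let ?v1 = "V1 e us" and ?v2 = "V2 (\<lambda>z. e (us @ z)) vs"
      have "V e (us @ vs) = ?v1 * ?v2" "Q (us @ vs) = Q1 us * Q2 vs"
        using us by (auto simp: V_def Q_def feedback_outputs_def)
      moreover have "(?v1 * ?v2 / (Q1 us * Q2 vs)) powr s = (?v1 / Q1 us) powr s * (?v2 / Q2 vs) powr s"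
        using V1(1)[OF us] V2(1)[OF vs] Q1(1)[OF us] Q2(1)[OF vs]
        by (intro powr_mult_quotients divide_nonneg_nonneg) (auto simp: less_imp_le)
      ultimately show "V e (us @ vs) * (V e (us @ vs) / Q (us @ vs)) powr s =
        (?v1 * (?v1 / Q1 us) powr s) * (?v2 * (?v2 / Q2 vs) powr s)" by simp
    qed
    also have "\<dots> \<le> exp (b1 + b2)"
      using b1 b2 V1(1) by (intro product_le) auto
    finally show "(\<Sum>ys\<in>?F (n + m). V e ys * (V e ys / Q ys) powr s) \<le> exp (b1 + b2)" .
  next
    have "(\<Sum>ys\<in>?F (n + m). V e ys * (V e ys / feedback_prob W (n + m) e ys) powr s) =
       (\<Sum>us\<in>?F n. \<Sum>vs\<in>?F m. (V1 e us * (V1 e us / feedback_prob W n e us) powr s) *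
         (V2 (\<lambda>z. e (us @ z)) vs * (V2 (\<lambda>z. e (us @ z)) vs / feedback_prob W m (\<lambda>z. e (us @ z)) vs) powr s))"
      unfolding sum_feedback_outputs_append
    proof (intro sum.cong refl)
      fix us vs assume us: "us \<in> ?F n" and vs: "vs \<in> ?F m"
      let ?v1 = "V1 e us" and ?v2 = "V2 (\<lambda>z. e (us @ z)) vs"
      let ?p1 = "feedback_prob W n e us" and ?p2 = "feedback_prob W m (\<lambda>z. e (us @ z)) vs"
      have "V e (us @ vs) = ?v1 * ?v2" "feedback_prob W (n + m) e (us @ vs) = ?p1 * ?p2"
        using us by (auto simp: V_def feedback_outputs_def feedback_prob_append)
      moreover have "(?v1 * ?v2 / (?p1 * ?p2)) powr s = (?v1 / ?p1) powr s * (?v2 / ?p2) powr s"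
        using V1(1)[OF us] V2(1)[OF vs] W0
        by (intro powr_mult_quotients divide_nonneg_nonneg) auto
      ultimately show "V e (us @ vs) * (V e (us @ vs) / feedback_prob W (n + m) e (us @ vs)) powr s =
        (?v1 * (?v1 / ?p1) powr s) * (?v2 * (?v2 / ?p2) powr s)" by simp
    qed
    also have "\<dots> \<le> exp (d1 + d2)"
      using d1 d2 V1(1) by (intro product_le) auto
    finally show "(\<Sum>ys\<in>?F (n + m). V e ys * (V e ys / feedback_prob W (n + m) e ys) powr s) \<le> exp (d1 + d2)" .
  qed
  moreover have "\<forall>ys\<in>?F (n + m). 0 < Q ys" using Q1(1) Q2(1) split by (simp add: Q_def)
  ultimately show ?thesis unfolding moment_bound_def using Qsum by blast
qed

section \<open>Leftover letters and repetition of a block\<close>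

lemma prob_dist_channel: "prob_dist q \<Longrightarrow> discrete_channel (\<lambda>_::unit. q)"
  by (simp add: prob_dist_def discrete_channel_def)

lemma sum_product_prob: "prob_dist q \<Longrightarrow> (\<Sum>ys\<in>feedback_outputs n. product_prob n q ys) = 1"
  by (rule sum_feedback_prob[OF prob_dist_channel])

lemma product_prob_uniform: "product_prob n (\<lambda>_. c) ys = c ^ n"
  by (simp add: feedback_prob_def)

text \<open>Meant for the letters after the last full block: V is the channel law itself, whose
  ratio to the uniform law is at most CARD('y)^n and whose ratio to itself is 1 on its
  support.\<close>

lemma moment_bound_untilted:
  fixes W :: "'x::finite \<Rightarrow> 'y::finite \<Rightarrow> real"
  assumes W: "discrete_channel W" and s: "0 \<le> s"
  shows "moment_bound W n s (s * (n * ln CARD('y))) 0"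
proof -
  let ?F = "feedback_outputs n :: 'y list set"
  define Q :: "'y list \<Rightarrow> real" where "Q ys = (1 / real CARD('y)) ^ n" for ys
  have Q0: "0 < Q ys" for ys by (simp add: Q_def)
  have "(\<Sum>ys\<in>?F. product_prob n (\<lambda>_. 1 / real CARD('y)) ys) = 1"
    by (intro sum_product_prob uniform_prob_dist)
  then have "(\<Sum>ys\<in>?F. Q ys) = 1" by (simp only: Q_def product_prob_uniform)
  moreover have "(\<Sum>ys\<in>?F. feedback_prob W n e ys * (feedback_prob W n e ys / Q ys) powr s)
      \<le> exp (s * (n * ln CARD('y)))" for e
  proof -
    have "(feedback_prob W n e ys / Q ys) powr s \<le> exp (s * (n * ln CARD('y)))" if ys: "ys \<in> ?F" for ys
    proof -
      have P0: "0 \<le> feedback_prob W n e zs" for zs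
        using channel_nonneg[OF W] by (rule feedback_prob_nonneg)
      then have "feedback_prob W n e ys \<le> (\<Sum>ys\<in>?F. feedback_prob W n e ys)"
        using ys by (intro member_le_sum) auto
      then have "feedback_prob W n e ys / Q ys \<le> 1 / Q ys"
        using sum_feedback_prob[OF W] Q0 by (intro divide_right_mono) (auto simp: less_imp_le)
      then have "(feedback_prob W n e ys / Q ys) powr s \<le> (1 / Q ys) powr s"
        using s P0 Q0 by (intro powr_mono2) (auto simp: less_imp_le)
      also have "\<dots> = exp (s * (n * ln CARD('y)))"
        by (simp add: Q_def power_one_over powr_def ln_realpow)
      finally show ?thesis .
    qed
    then have "(\<Sum>ys\<in>?F. feedback_prob W n e ys * (feedback_prob W n e ys / Q ys) powr s)
      \<le> (\<Sum>ys\<in>?F. feedback_prob W n e ys * exp (s * (n * ln CARD('y))))"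
      using feedback_prob_nonneg[OF channel_nonneg[OF W]] by (intro sum_mono mult_left_mono) auto
    also have "\<dots> = exp (s * (n * ln CARD('y)))"
      using sum_feedback_prob[OF W, of n e] by (simp flip: sum_distrib_right)
    finally show ?thesis .
  qed
  moreover have "(\<Sum>ys\<in>?F. feedback_prob W n e ys * (feedback_prob W n e ys / feedback_prob W n e ys) powr s) \<le> exp 0" for e
  proof -
    have "feedback_prob W n e ys * (feedback_prob W n e ys / feedback_prob W n e ys) powr s
        = feedback_prob W n e ys" for ys by simp
    then show ?thesis by (simp only: sum_feedback_prob[OF W] exp_zero order_refl)
  qed
  moreover have "0 \<le> feedback_prob W n e ys" for e ys
    using channel_nonneg[OF W] by (rule feedback_prob_nonneg)
  ultimately show ?thesis
    unfolding moment_bound_def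
    by (intro exI[of _ Q] exI[of _ "feedback_prob W n"] conjI allI ballI impI Q0 sum_feedback_prob[OF W])
qed

lemma moment_bound_power:
  fixes W :: "'x::finite \<Rightarrow> 'y::finite \<Rightarrow> real"
  assumes W: "discrete_channel W" and s: "0 \<le> s" and block: "moment_bound W l s b d"
  shows "moment_bound W (k * l + r) s (k * b + s * (r * ln CARD('y))) (k * d)"
proof (induction k)
  case 0
  then show ?case using moment_bound_untilted[OF W s] by simp
next
  case (Suc k)
  from moment_bound_add[OF W block this] show ?case by (simp add: algebra_simps)
qed

text \<open>Q dominates each component divided by N, so passing from a component to Q in a tilted
  sum costs the factor N powr (\<alpha> - 1), that is, ln N added to the capacity term. The uniform
  component keeps Q away from 0.\<close>

lemma mixture_of_centers:
  fixes W :: "'x::finite \<Rightarrow> 'y::finite \<Rightarrow> real" and A :: "real set"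
  assumes W: "discrete_channel W" and A: "finite A" "A \<subseteq> {0<..<1}"
  defines "N \<equiv> real (card A + 1)"
  obtains Q where "\<And>ys. (1 / CARD('y)) ^ l / N \<le> Q ys"
    "(\<Sum>ys\<in>feedback_outputs l. Q ys) = 1"
    "\<And>e \<alpha> a. a \<in> A \<Longrightarrow> 0 < \<alpha> \<Longrightarrow> \<alpha> \<le> a \<Longrightarrow>
      exp (- (1 - \<alpha>) * (l * renyi_capacity a W + ln N))
        \<le> (\<Sum>ys\<in>feedback_outputs l. feedback_prob W l e ys powr \<alpha> * Q ys powr (1 - \<alpha>))"
proof -
  have "\<forall>a\<in>A. \<exists>q. prob_dist q \<and> (\<forall>\<beta> x. 0 < \<beta> \<longrightarrow> \<beta> \<le> a \<longrightarrow>
      exp ((\<beta> - 1) * renyi_capacity a W) \<le> (\<Sum>y\<in>UNIV. W x y powr \<beta> * q y powr (1 - \<beta>)))"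
  proof
    fix a assume "a \<in> A"
    then have "0 < a" "a < 1" using A by auto
    from renyi_center[OF W this] show "\<exists>q. prob_dist q \<and> (\<forall>\<beta> x. 0 < \<beta> \<longrightarrow> \<beta> \<le> a \<longrightarrow>
      exp ((\<beta> - 1) * renyi_capacity a W) \<le> (\<Sum>y\<in>UNIV. W x y powr \<beta> * q y powr (1 - \<beta>)))" by metis
  qed
  then obtain q where q: "\<And>a. a \<in> A \<Longrightarrow> prob_dist (q a)"
    and center: "\<And>a \<beta> x. a \<in> A \<Longrightarrow> 0 < \<beta> \<Longrightarrow> \<beta> \<le> a \<Longrightarrow>
      exp ((\<beta> - 1) * renyi_capacity a W) \<le> (\<Sum>y\<in>UNIV. W x y powr \<beta> * q a y powr (1 - \<beta>))"
    by metis
  define Q where "Q ys = ((1 / real CARD('y)) ^ l + (\<Sum>a\<in>A. product_prob l (q a) ys)) / N" for ys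
  have N: "0 < N" by (simp add: N_def)
  have q0: "0 \<le> product_prob l (q a) ys" if "a \<in> A" for a ys
    using q[OF that] by (intro feedback_prob_nonneg) (auto simp: prob_dist_def)
  show ?thesis
  proof
    show "(1 / CARD('y)) ^ l / N \<le> Q ys" for ys
      unfolding Q_def using N q0 by (intro divide_right_mono) (auto intro!: sum_nonneg)
    have "(\<Sum>ys\<in>feedback_outputs l. \<Sum>a\<in>A. product_prob l (q a) ys) = (\<Sum>a\<in>A. 1)"
      by (subst sum.swap) (intro sum.cong refl sum_feedback_prob prob_dist_channel q)
    moreover have "(\<Sum>ys\<in>(feedback_outputs l :: 'y list set). product_prob l (\<lambda>_. 1 / real CARD('y)) ys) = 1"
      by (intro sum_product_prob uniform_prob_dist)
    then have "(\<Sum>ys\<in>(feedback_outputs l :: 'y list set). (1 / real CARD('y)) ^ l) = 1"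
      by (simp only: product_prob_uniform)
    ultimately have "(\<Sum>ys\<in>(feedback_outputs l :: 'y list set).
        (1 / real CARD('y)) ^ l + (\<Sum>a\<in>A. product_prob l (q a) ys)) = N"
      by (simp only: sum.distrib) (simp add: N_def)
    then show "(\<Sum>ys\<in>feedback_outputs l. Q ys) = 1"
      using N by (simp only: Q_def sum_divide_distrib[symmetric]) simp
    fix e \<alpha> a assume a: "a \<in> A" and \<alpha>: "0 < \<alpha>" "\<alpha> \<le> a"
    then have "\<alpha> < 1" using A by force
    let ?B = "exp ((\<alpha> - 1) * renyi_capacity a W)"
    have "exp (- (1 - \<alpha>) * (l * renyi_capacity a W + ln N)) = ?B ^ l * (1 / N) powr (1 - \<alpha>)"
      using N by (simp add: powr_def ln_div exp_add[symmetric] exp_of_nat_mult[symmetric] algebra_simps)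
    also have "\<dots> \<le> (\<Sum>ys\<in>feedback_outputs l. feedback_prob W l e ys powr \<alpha> * product_prob l (q a) ys powr (1 - \<alpha>))
        * (1 / N) powr (1 - \<alpha>)"
      by (intro mult_right_mono feedback_tilted_sum_ge[OF W q[OF a]] center[OF a \<alpha>]) auto
    also have "\<dots> = (\<Sum>ys\<in>feedback_outputs l. feedback_prob W l e ys powr \<alpha> * (product_prob l (q a) ys / N) powr (1 - \<alpha>))"
      unfolding sum_distrib_right using q0[OF a] N by (intro sum.cong refl) (simp add: powr_divide)
    also have "\<dots> \<le> (\<Sum>ys\<in>feedback_outputs l. feedback_prob W l e ys powr \<alpha> * Q ys powr (1 - \<alpha>))"
    proof (intro sum_mono mult_left_mono powr_mono2)
      fix ys :: "'y list"
      have "product_prob l (q a) ys \<le> (\<Sum>a\<in>A. product_prob l (q a) ys)"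
        using a q0 A by (intro member_le_sum) auto
      also have "\<dots> \<le> (1 / real CARD('y)) ^ l + (\<Sum>a\<in>A. product_prob l (q a) ys)" by simp
      finally show "product_prob l (q a) ys / N \<le> Q ys"
        unfolding Q_def using N by (intro divide_right_mono) auto
      show "0 \<le> product_prob l (q a) ys / N" using q0[OF a] N by simp
    qed (use \<open>\<alpha> < 1\<close> in auto)
    finally show "exp (- (1 - \<alpha>) * (l * renyi_capacity a W + ln N))
        \<le> (\<Sum>ys\<in>feedback_outputs l. feedback_prob W l e ys powr \<alpha> * Q ys powr (1 - \<alpha>))" .
  qed
qed

text \<open>\<open>low\<close>, \<open>mid\<close> and \<open>high\<close> are the hypotheses of
  \<open>tilted_distribution\<close> with - ln Z replaced by its bound from a grid order a not below
  the order in question. c bounds both log-likelihood ratios because V <= 1, Q contains the uniform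
  law and positive values of P are at least exp (- l \<mu>).\<close>

lemma moment_bound_block:
  fixes W :: "'x::finite \<Rightarrow> 'y::finite \<Rightarrow> real" and A :: "real set"
  assumes W: "discrete_channel W" and A: "finite A" "A \<subseteq> {0<..<1}"
    and \<alpha>: "0 < \<alpha>0" "\<alpha>0 \<le> \<alpha>1" "\<alpha>1 < 1"
  defines "N \<equiv> real (card A + 1)"
  assumes low: "\<exists>a\<in>A. \<alpha>0 \<le> a \<and> l * renyi_capacity a W + ln N \<le> \<rho>"
    and mid: "\<And>\<alpha>. \<alpha>0 \<le> \<alpha> \<Longrightarrow> \<alpha> \<le> \<alpha>1 \<Longrightarrow>
      \<exists>a\<in>A. \<alpha> \<le> a \<and> (1 - \<alpha>) * (l * renyi_capacity a W + ln N - \<rho>) \<le> \<alpha> * \<delta>"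
    and high: "\<exists>a\<in>A. \<alpha>1 \<le> a \<and> (1 - \<alpha>1) * (l * renyi_capacity a W + ln N) \<le> \<alpha>1 * \<delta>"
    and \<mu>: "\<And>x y. 0 < W x y \<Longrightarrow> exp (- \<mu>) \<le> W x y"
    and c: "l * ln CARD('y) + ln N \<le> c" "l * \<mu> \<le> c" "0 \<le> c"
    and s: "0 \<le> s" "s * c \<le> 1"
  shows "moment_bound W l s (s * \<rho> + s\<^sup>2 * (c\<^sup>2 + 1)) (s * \<delta> + s\<^sup>2 * (c\<^sup>2 + 1))"
proof -
  let ?F = "feedback_outputs l :: 'y list set"
  obtain Q where Qlow: "\<And>ys. (1 / CARD('y)) ^ l / N \<le> Q ys" and Qsum: "(\<Sum>ys\<in>?F. Q ys) = 1"
    and QZ: "\<And>e \<alpha> a. a \<in> A \<Longrightarrow> 0 < \<alpha> \<Longrightarrow> \<alpha> \<le> a \<Longrightarrow>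
      exp (- (1 - \<alpha>) * (l * renyi_capacity a W + ln N))
        \<le> (\<Sum>ys\<in>?F. feedback_prob W l e ys powr \<alpha> * Q ys powr (1 - \<alpha>))"
    using mixture_of_centers[OF W A, of l] unfolding N_def by blast
  have N: "0 < N" by (simp add: N_def)
  have Q0: "0 < Q ys" for ys
  proof -
    have "0 < (1 / real CARD('y)) ^ l / N" using N by simp
    then show ?thesis using Qlow[of ys] by linarith
  qed
  have "\<exists>V. (\<forall>ys\<in>?F. 0 \<le> V ys) \<and> (\<Sum>ys\<in>?F. V ys) = 1 \<and>
        (\<forall>ys\<in>?F. feedback_prob W l e ys = 0 \<longrightarrow> V ys = 0) \<and>
        (\<Sum>ys\<in>?F. V ys * (V ys / Q ys) powr s) \<le> exp (s * \<rho> + s\<^sup>2 * (c\<^sup>2 + 1)) \<and>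
        (\<Sum>ys\<in>?F. V ys * (V ys / feedback_prob W l e ys) powr s) \<le> exp (s * \<delta> + s\<^sup>2 * (c\<^sup>2 + 1))" for e
  proof -
    let ?P = "feedback_prob W l e"
    define Z where "Z \<alpha> = (\<Sum>ys\<in>?F. ?P ys powr \<alpha> * Q ys powr (1 - \<alpha>))" for \<alpha>
    have P0: "0 \<le> ?P ys" for ys using channel_nonneg[OF W] by (rule feedback_prob_nonneg)
    have Z: "- ln (Z \<alpha>) \<le> (1 - \<alpha>) * (l * renyi_capacity a W + ln N)" if "a \<in> A" "0 < \<alpha>" "\<alpha> \<le> a" for \<alpha> a
    proof -
      have "exp (- (1 - \<alpha>) * (l * renyi_capacity a W + ln N)) \<le> Z \<alpha>"
        using QZ[OF that] by (simp add: Z_def)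
      then have "- (1 - \<alpha>) * (l * renyi_capacity a W + ln N) \<le> ln (Z \<alpha>)"
        by (meson exp_gt_zero less_le_trans ln_ge_iff)
      then show ?thesis by (simp add: algebra_simps)
    qed
    have zlow: "- ln (Z \<alpha>0) \<le> (1 - \<alpha>0) * \<rho>"
    proof -
      obtain a where a: "a \<in> A" "\<alpha>0 \<le> a" "l * renyi_capacity a W + ln N \<le> \<rho>" using low by blast
      have "- ln (Z \<alpha>0) \<le> (1 - \<alpha>0) * (l * renyi_capacity a W + ln N)" using Z a \<alpha> by auto
      also have "\<dots> \<le> (1 - \<alpha>0) * \<rho>" using a \<alpha> by (intro mult_left_mono) auto
      finally show ?thesis .
    qed
    have zmid: "- ln (Z \<alpha>) - (1 - \<alpha>) * \<rho> \<le> \<alpha> * \<delta>" if h: "\<alpha>0 \<le> \<alpha>" "\<alpha> \<le> \<alpha>1" for \<alpha>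
    proof -
      obtain a where a: "a \<in> A" "\<alpha> \<le> a" "(1 - \<alpha>) * (l * renyi_capacity a W + ln N - \<rho>) \<le> \<alpha> * \<delta>"
        using mid[OF h] by blast
      have "- ln (Z \<alpha>) \<le> (1 - \<alpha>) * (l * renyi_capacity a W + ln N)" using Z a \<alpha> h by auto
      then show ?thesis using a(3) by (simp add: algebra_simps)
    qed
    have zhigh: "- ln (Z \<alpha>1) \<le> \<alpha>1 * \<delta>"
    proof -
      obtain a where a: "a \<in> A" "\<alpha>1 \<le> a" "(1 - \<alpha>1) * (l * renyi_capacity a W + ln N) \<le> \<alpha>1 * \<delta>"
        using high by blast
      have "- ln (Z \<alpha>1) \<le> (1 - \<alpha>1) * (l * renyi_capacity a W + ln N)" using Z a \<alpha> by auto
      then show ?thesis using a by linarith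
    qed
    obtain V where V: "\<And>ys. ys \<in> ?F \<Longrightarrow> 0 \<le> V ys" "(\<Sum>ys\<in>?F. V ys) = 1"
      "\<And>ys. ys \<in> ?F \<Longrightarrow> ?P ys = 0 \<Longrightarrow> V ys = 0"
      "(\<Sum>ys\<in>?F. V ys * ln (V ys / Q ys)) \<le> \<rho>" "(\<Sum>ys\<in>?F. V ys * ln (V ys / ?P ys)) \<le> \<delta>"
      by (rule tilted_distribution[of ?F ?P Q \<alpha>0 \<alpha>1 \<rho> \<delta>])
        (use P0 Q0 sum_feedback_prob[OF W] Qsum \<alpha> zlow zmid zhigh in \<open>auto simp: Z_def\<close>)
    have V_le_1: "V ys \<le> 1" if "ys \<in> ?F" for ys
      using member_le_sum[of ys ?F V] that V(1,2) by auto
    have "(\<Sum>ys\<in>?F. V ys * (V ys / Q ys) powr s) \<le> exp (s * \<rho> + s\<^sup>2 * (c\<^sup>2 + 1))"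
    proof (rule likelihood_ratio_moment_le)
      fix ys assume ys: "ys \<in> ?F" "0 < V ys"
      have "V ys / Q ys \<le> 1 / ((1 / real CARD('y)) ^ l / N)"
        using V_le_1[OF ys(1)] Qlow[of ys] ys N by (intro frac_le) auto
      also have "\<dots> = real CARD('y) ^ l * N" by (simp add: power_one_over)
      finally have "ln (V ys / Q ys) \<le> ln (real CARD('y) ^ l * N)"
        using ys Q0 N by (subst ln_le_cancel_iff) auto
      also have "\<dots> = l * ln CARD('y) + ln N" using N by (simp add: ln_mult ln_realpow)
      finally show "ln (V ys / Q ys) \<le> c" using c by linarith
    qed (use V Q0 Qsum s c in \<open>auto simp: less_imp_le less_imp_neq[THEN not_sym]\<close>)
    moreover have "(\<Sum>ys\<in>?F. V ys * (V ys / ?P ys) powr s) \<le> exp (s * \<delta> + s\<^sup>2 * (c\<^sup>2 + 1))"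
    proof (rule likelihood_ratio_moment_le)
      fix ys assume ys: "ys \<in> ?F" "0 < V ys"
      then have Ppos: "?P ys \<noteq> 0" using V(3) by force
      have "exp (- (l * \<mu>)) = (\<Prod>t<l. exp (- \<mu>))" by (simp flip: exp_of_nat_mult)
      also have "\<dots> \<le> ?P ys"
        unfolding feedback_prob_def
      proof (intro prod_mono conjI \<mu>)
        fix t assume "t \<in> {..<l}"
        then have "W (e (take t ys)) (ys ! t) \<noteq> 0" using Ppos by (auto simp: feedback_prob_def)
        then show "0 < W (e (take t ys)) (ys ! t)" using channel_nonneg[OF W] by (simp add: less_le)
      qed simp
      finally have "V ys / ?P ys \<le> 1 / exp (- (l * \<mu>))"
        using V_le_1[OF ys(1)] ys by (intro frac_le) auto
      then have "V ys / ?P ys \<le> exp (l * \<mu>)" by (simp add: exp_minus field_simps)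
      moreover have "0 < V ys / ?P ys" using ys Ppos P0[of ys] by (simp add: less_le)
      ultimately have "ln (V ys / ?P ys) \<le> l * \<mu>" by (metis exp_gt_zero ln_exp ln_le_cancel_iff)
      then show "ln (V ys / ?P ys) \<le> c" using c by linarith
    qed (use V P0 sum_feedback_prob[OF W] s c in auto)
    ultimately show ?thesis using V by blast
  qed
  then have "\<forall>e. \<exists>V. (\<forall>ys\<in>?F. 0 \<le> V ys) \<and> (\<Sum>ys\<in>?F. V ys) = 1 \<and>
        (\<forall>ys\<in>?F. feedback_prob W l e ys = 0 \<longrightarrow> V ys = 0) \<and>
        (\<Sum>ys\<in>?F. V ys * (V ys / Q ys) powr s) \<le> exp (s * \<rho> + s\<^sup>2 * (c\<^sup>2 + 1)) \<and>
        (\<Sum>ys\<in>?F. V ys * (V ys / feedback_prob W l e ys) powr s) \<le> exp (s * \<delta> + s\<^sup>2 * (c\<^sup>2 + 1))" by blast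
  from choice[OF this] show ?thesis unfolding moment_bound_def using Q0 Qsum by blast
qed

text \<open>Where V <= exp \<delta> P and V <= exp \<theta> Q, the P mass of errors is at least exp
  (- \<delta>) times their V mass, and the V mass of correct decoding is at most exp \<theta> times
  its Q mass. Markov's inequality with the moments of order s bounds the other outputs. The Q mass
  of correct decoding averages to L / M because Q is the same for all messages.\<close>

lemma avg_error_ge:
  fixes W :: "'x::finite \<Rightarrow> 'y::finite \<Rightarrow> real"
  assumes W: "discrete_channel W" and code: "is_list_code n M L f \<psi>"
    and mb: "moment_bound W n s b d" and s: "0 < s"
  shows "exp (- \<delta>) * (1 - exp (d - s * \<delta>) - exp (b - s * \<theta>) - exp \<theta> * (real L / real M)) \<le> avg_error W n M f \<psi>"
proof -
  let ?F = "feedback_outputs n :: 'y list set"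
  obtain Q V where Q: "\<And>ys. ys \<in> ?F \<Longrightarrow> 0 < Q ys" "(\<Sum>ys\<in>?F. Q ys) = 1"
    and V: "\<And>e ys. ys \<in> ?F \<Longrightarrow> 0 \<le> V e ys" "\<And>e. (\<Sum>ys\<in>?F. V e ys) = 1"
      "\<And>e ys. ys \<in> ?F \<Longrightarrow> feedback_prob W n e ys = 0 \<Longrightarrow> V e ys = 0"
    and b: "\<And>e. (\<Sum>ys\<in>?F. V e ys * (V e ys / Q ys) powr s) \<le> exp b"
    and d: "\<And>e. (\<Sum>ys\<in>?F. V e ys * (V e ys / feedback_prob W n e ys) powr s) \<le> exp d"
    using moment_boundE[OF mb] by blast
  have M: "1 \<le> M" and \<psi>: "\<And>ys. ys \<in> ?F \<Longrightarrow> \<psi> ys \<subseteq> {1..M}" "\<And>ys. ys \<in> ?F \<Longrightarrow> card (\<psi> ys) = L"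
    using code by (auto simp: is_list_code_def)
  have ratio: "1 \<le> x powr s * exp (- s * t)" if "exp t < x" for x t :: real
  proof -
    have "exp t powr s \<le> x powr s" using that s by (intro powr_mono2) auto
    then have "exp (s * t) \<le> x powr s" by (simp add: powr_def)
    then have "exp (s * t) * exp (- s * t) \<le> x powr s * exp (- s * t)" by (intro mult_right_mono) auto
    then show ?thesis by (simp flip: exp_add)
  qed
  have err: "exp (- \<delta>) * (1 - exp (d - s * \<delta>) - exp (b - s * \<theta>) - exp \<theta> * (\<Sum>ys\<in>{ys\<in>?F. m \<in> \<psi> ys}. Q ys))
      \<le> (\<Sum>ys\<in>{ys\<in>?F. m \<notin> \<psi> ys}. feedback_prob W n (f m) ys)" for m
  proof -
    let ?P = "feedback_prob W n (f m)" and ?V = "V (f m)"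
    have P0: "0 \<le> ?P ys" for ys using channel_nonneg[OF W] by (rule feedback_prob_nonneg)
    \<comment> \<open>Either one of the two Markov terms already exceeds \<open>V\<close>, or both likelihood ratios are small.\<close>
    have pw: "?V ys - ?V ys * (?V ys / ?P ys) powr s * exp (- s * \<delta>)
        - ?V ys * (?V ys / Q ys) powr s * exp (- s * \<theta>) - exp \<theta> * (if m \<in> \<psi> ys then Q ys else 0)
        \<le> exp \<delta> * (if m \<notin> \<psi> ys then ?P ys else 0)" if ys: "ys \<in> ?F" for ys
    proof -
      note nn = V(1)[OF ys, of "f m"] P0[of ys] Q(1)[OF ys]
      have t1: "0 \<le> ?V ys * ((?V ys / ?P ys) powr s * exp (- s * \<delta>))"
        and t2: "0 \<le> ?V ys * ((?V ys / Q ys) powr s * exp (- s * \<theta>))"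
        and t3: "0 \<le> exp \<theta> * (if m \<in> \<psi> ys then Q ys else 0)"
        and t4: "0 \<le> exp \<delta> * (if m \<notin> \<psi> ys then ?P ys else 0)"
        using nn by auto
      consider "exp \<delta> < ?V ys / ?P ys" | "exp \<theta> < ?V ys / Q ys"
        | "?V ys / ?P ys \<le> exp \<delta>" "?V ys / Q ys \<le> exp \<theta>" by linarith
      then show ?thesis
      proof cases
        case 1
        from mult_left_mono[OF ratio[OF this] nn(1)] t2 t3 t4 show ?thesis
          unfolding mult.assoc by linarith
      next
        case 2
        from mult_left_mono[OF ratio[OF this] nn(1)] t1 t3 t4 show ?thesis
          unfolding mult.assoc by linarith
      next
        case 3
        have "?V ys \<le> exp \<theta> * Q ys" using 3(2) nn(3) by (simp add: pos_divide_le_eq)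
        moreover have "?V ys \<le> exp \<delta> * ?P ys"
          using 3(1) nn V(3)[OF ys, of "f m"] by (cases "?P ys = 0") (auto simp: pos_divide_le_eq less_le)
        ultimately show ?thesis using t1 t2 unfolding mult.assoc by auto
      qed
    qed
    have "1 - exp d * exp (- s * \<delta>) - exp b * exp (- s * \<theta>) - exp \<theta> * (\<Sum>ys\<in>{ys\<in>?F. m \<in> \<psi> ys}. Q ys)
       \<le> (\<Sum>ys\<in>?F. ?V ys) - (\<Sum>ys\<in>?F. ?V ys * (?V ys / ?P ys) powr s) * exp (- s * \<delta>)
        - (\<Sum>ys\<in>?F. ?V ys * (?V ys / Q ys) powr s) * exp (- s * \<theta>) - exp \<theta> * (\<Sum>ys\<in>?F. if m \<in> \<psi> ys then Q ys else 0)"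
      unfolding V(2) sum.inter_filter[OF finite_feedback_outputs]
      by (intro diff_mono mult_right_mono b d order_refl) auto
    also have "\<dots> \<le> (\<Sum>ys\<in>?F. exp \<delta> * (if m \<notin> \<psi> ys then ?P ys else 0))"
      unfolding sum_distrib_left sum_distrib_right sum_subtractf[symmetric]
      by (intro sum_mono pw)
    also have "\<dots> = exp \<delta> * (\<Sum>ys\<in>{ys\<in>?F. m \<notin> \<psi> ys}. ?P ys)"
      by (simp add: sum.inter_filter sum_distrib_left)
    finally have "exp (- \<delta>) * (1 - exp d * exp (- s * \<delta>) - exp b * exp (- s * \<theta>) - exp \<theta> * (\<Sum>ys\<in>{ys\<in>?F. m \<in> \<psi> ys}. Q ys))
      \<le> exp (- \<delta>) * (exp \<delta> * (\<Sum>ys\<in>{ys\<in>?F. m \<notin> \<psi> ys}. ?P ys))"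
      by (intro mult_left_mono) auto
    then show ?thesis by (simp add: exp_minus exp_diff field_simps)
  qed
  \<comment> \<open>Double counting: each output lies in the decoding sets of exactly L
    messages.\<close>
  have "(\<Sum>m\<in>{1..M}. \<Sum>ys\<in>{ys\<in>?F. m \<in> \<psi> ys}. Q ys) = (\<Sum>ys\<in>?F. \<Sum>m\<in>{1..M}. if m \<in> \<psi> ys then Q ys else 0)"
    by (subst sum.swap) (simp add: sum.inter_filter)
  also have "\<dots> = (\<Sum>ys\<in>?F. L * Q ys)"
  proof (intro sum.cong refl)
    fix ys assume ys: "ys \<in> ?F"
    have "{m \<in> {1..M}. m \<in> \<psi> ys} = \<psi> ys" using \<psi>(1)[OF ys] by auto
    then show "(\<Sum>m\<in>{1..M}. if m \<in> \<psi> ys then Q ys else 0) = L * Q ys"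
      using \<psi>(2)[OF ys] by (simp flip: sum.inter_filter)
  qed
  also have "\<dots> = L" using Q(2) by (simp flip: sum_distrib_left)
  finally have total: "(\<Sum>m\<in>{1..M}. \<Sum>ys\<in>{ys\<in>?F. m \<in> \<psi> ys}. Q ys) = real L" .
  let ?k = "1 - exp (d - s * \<delta>) - exp (b - s * \<theta>)"
  have "(\<Sum>m\<in>{1..M}. exp (- \<delta>) * (?k - exp \<theta> * (\<Sum>ys\<in>{ys\<in>?F. m \<in> \<psi> ys}. Q ys)))
      = exp (- \<delta>) * (M * ?k - exp \<theta> * L)"
    using total by (simp only: sum_distrib_left[symmetric] sum_subtractf sum_constant) (simp add: algebra_simps)
  moreover have "(\<Sum>m\<in>{1..M}. exp (- \<delta>) * (?k - exp \<theta> * (\<Sum>ys\<in>{ys\<in>?F. m \<in> \<psi> ys}. Q ys)))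
      \<le> (\<Sum>m\<in>{1..M}. \<Sum>ys\<in>{ys\<in>?F. m \<notin> \<psi> ys}. feedback_prob W n (f m) ys)"
    by (intro sum_mono err)
  ultimately have "exp (- \<delta>) * (M * ?k - exp \<theta> * L)
      \<le> (\<Sum>m\<in>{1..M}. \<Sum>ys\<in>{ys\<in>?F. m \<notin> \<psi> ys}. feedback_prob W n (f m) ys)"
    by simp
  then have "1 / M * (exp (- \<delta>) * (M * ?k - exp \<theta> * L)) \<le> avg_error W n M f \<psi>"
    unfolding avg_error_def by (intro mult_left_mono) auto
  moreover have "1 / M * (exp (- \<delta>) * (M * ?k - exp \<theta> * L)) = exp (- \<delta>) * (?k - exp \<theta> * (L / M))"
    using M by (simp add: field_simps)
  ultimately show ?thesis by simp
qed

section \<open>Choice of the orders and of the block length\<close>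

text \<open>Orders are rounded up because a center serves the orders below its own, and the grid
  stops one step short of 1 because centers exist here for orders below 1. \<open>\<alpha>1\<close>
  is the last grid point, not the order of that name in the theorem.\<close>

lemma order_grid:
  fixes \<alpha>0 :: real
  assumes \<alpha>0: "0 < \<alpha>0" "\<alpha>0 < 1" and K: "1 \<le> K"
  obtains A \<alpha>1 where "finite A" "A \<subseteq> {0<..<1}" "card A \<le> K" "\<alpha>0 \<in> A" "\<alpha>1 \<in> A" "\<alpha>0 \<le> \<alpha>1" "1 - \<alpha>1 \<le> 1 / real K"
    "\<And>\<alpha>. \<alpha>0 \<le> \<alpha> \<Longrightarrow> \<alpha> \<le> \<alpha>1 \<Longrightarrow> \<exists>a\<in>A. \<alpha> \<le> a \<and> a \<le> \<alpha> + 1 / real K"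
proof -
  define g where "g k = \<alpha>0 + (1 - \<alpha>0) * (real k / real K)" for k :: nat
  have K0: "0 < real K" using K by simp
  have g1: "g k < 1" if "k < K" for k
  proof -
    have "real k / real K < 1" using that K0 by simp
    then have "(1 - \<alpha>0) * (real k / real K) < (1 - \<alpha>0) * 1" using \<alpha>0 by (intro mult_strict_left_mono) auto
    then show ?thesis by (simp add: g_def)
  qed
  have g0: "\<alpha>0 \<le> g k" for k using \<alpha>0 by (simp add: g_def)
  show ?thesis
  proof
    show "finite (g ` {..<K})" "card (g ` {..<K}) \<le> K" using card_image_le[of "{..<K}" g] by auto
    show "g ` {..<K} \<subseteq> {0<..<1}" using g0 g1 \<alpha>0 by (force intro: less_le_trans)
    show "\<alpha>0 \<in> g ` {..<K}" using K by (intro image_eqI[of _ _ 0]) (auto simp: g_def)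
    show "g (K - 1) \<in> g ` {..<K}" "\<alpha>0 \<le> g (K - 1)" using K g0 by auto
    have "1 - g (K - 1) = (1 - \<alpha>0) / real K" using K by (simp add: g_def of_nat_diff field_simps)
    also have "\<dots> \<le> 1 / real K" using \<alpha>0 by (intro divide_right_mono) auto
    finally show "1 - g (K - 1) \<le> 1 / real K" .
    fix \<alpha> assume \<alpha>: "\<alpha>0 \<le> \<alpha>" "\<alpha> \<le> g (K - 1)"
    define z where "z = (\<alpha> - \<alpha>0) / (1 - \<alpha>0) * real K"
    define k where "k = nat \<lceil>z\<rceil>"
    have z0: "0 \<le> z" using \<alpha> \<alpha>0 by (simp add: z_def)
    have "z \<le> real (K - 1)"
    proof -
      have "\<alpha> - \<alpha>0 \<le> (1 - \<alpha>0) * (real (K - 1) / real K)" using \<alpha>(2) by (simp add: g_def)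
      then have "(\<alpha> - \<alpha>0) / (1 - \<alpha>0) \<le> real (K - 1) / real K" using \<alpha>0 by (simp add: pos_divide_le_eq mult.commute)
      then show ?thesis using K0 by (simp add: z_def pos_le_divide_eq)
    qed
    then have "\<lceil>z\<rceil> \<le> int (K - 1)" by (simp add: ceiling_le_iff)
    then have "k < K" using K by (auto simp: k_def)
    have kz: "z \<le> real k" "real k \<le> z + 1" using z0 by (auto simp: k_def)
    have \<alpha>_eq: "\<alpha> = \<alpha>0 + (1 - \<alpha>0) * (z / real K)" using \<alpha>0 K0 by (simp add: z_def)
    have "\<alpha> \<le> g k"
      unfolding \<alpha>_eq g_def using kz \<alpha>0 by (intro add_left_mono mult_left_mono divide_right_mono) auto
    moreover have "g k \<le> \<alpha> + 1 / real K"
    proof -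
      have "g k \<le> \<alpha>0 + (1 - \<alpha>0) * ((z + 1) / real K)"
        unfolding g_def using kz \<alpha>0 by (intro add_left_mono mult_left_mono divide_right_mono) auto
      also have "\<dots> = \<alpha> + (1 - \<alpha>0) / real K" unfolding \<alpha>_eq by (simp add: add_divide_distrib algebra_simps)
      also have "\<dots> \<le> \<alpha> + 1 / real K" using \<alpha>0 by (intro add_left_mono divide_right_mono) auto
      finally show ?thesis .
    qed
    ultimately show "\<exists>a\<in>g ` {..<K}. \<alpha> \<le> a \<and> a \<le> \<alpha> + 1 / real K" using \<open>k < K\<close> by blast
  qed
qed

text \<open>The terms of \<open>\<eta>\<close>: on a grid of l points, rounding the order changes (1
  - \<alpha>) / \<alpha> by at most 1 / (l \<alpha>0^2), which is multiplied by l ln CARD('y); the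
  averaging cost ln N <= ln (l + 1) and the lowering \<xi> of the target rate are multiplied by (1 -
  \<alpha>) / \<alpha> <= 1 / \<alpha>0. The slack \<xi> will pay for the fluctuations of the ratio
  to Q and for the leftover letters.\<close>

lemma moment_bound_sphere_packing:
  fixes W :: "'x::finite \<Rightarrow> 'y::finite \<Rightarrow> real"
  assumes W: "discrete_channel W" and \<alpha>0: "0 < \<alpha>0" "\<alpha>0 < 1" and l: "1 \<le> l" and \<xi>: "0 \<le> \<xi>"
    and R: "l * renyi_capacity \<alpha>0 W + ln (real l + 1) + \<xi> \<le> l * R"
    and \<mu>: "\<And>x y. 0 < W x y \<Longrightarrow> exp (- \<mu>) \<le> W x y" "0 \<le> \<mu>"
  defines "c \<equiv> (ln CARD('y) + 1 + \<mu>) * l"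
    and "\<eta> \<equiv> ln CARD('y) / \<alpha>0\<^sup>2 + ln (real l + 1) / \<alpha>0 + \<xi> / \<alpha>0"
  assumes s: "0 \<le> s" "s * c \<le> 1"
  shows "moment_bound W l s (s * (l * R - \<xi>) + s\<^sup>2 * (c\<^sup>2 + 1))
    (s * (l * sphere_packing_exp R W + \<eta>) + s\<^sup>2 * (c\<^sup>2 + 1))"
proof -
  define E where "E = sphere_packing_exp R W"
  define LY where "LY = ln (real CARD('y))"
  have LY: "0 \<le> LY" by (simp add: LY_def)
  have l0: "0 < real l" using l by simp
  have lnl: "0 \<le> ln (real l + 1)" "ln (real l + 1) \<le> real l"
    using ln_add_one_self_le_self[of "real l"] by (auto simp: add.commute)
  have "l * renyi_capacity \<alpha>0 W \<le> l * R" using R lnl \<xi> by linarith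
  then have CR: "renyi_capacity \<alpha>0 W \<le> R" using l0 by simp
  have R0: "0 \<le> R" using renyi_capacity_nonneg[OF W \<alpha>0(1)] \<alpha>0 CR by linarith
  have E0: "0 \<le> E" unfolding E_def using sphere_packing_exp_nonneg[OF W \<alpha>0 CR] .
  obtain A \<alpha>1 where A: "finite A" "A \<subseteq> {0<..<1}" "card A \<le> l" "\<alpha>0 \<in> A" "\<alpha>1 \<in> A" "\<alpha>0 \<le> \<alpha>1" "1 - \<alpha>1 \<le> 1 / real l"
    and near: "\<And>\<alpha>. \<alpha>0 \<le> \<alpha> \<Longrightarrow> \<alpha> \<le> \<alpha>1 \<Longrightarrow> \<exists>a\<in>A. \<alpha> \<le> a \<and> a \<le> \<alpha> + 1 / real l"
    using order_grid[OF \<alpha>0 l] by blast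
  have \<alpha>1: "\<alpha>1 < 1" using A by auto
  define N where "N = real (card A + 1)"
  have N: "0 \<le> ln N" "ln N \<le> ln (real l + 1)" using A by (auto simp: N_def)
  have cap_le: "renyi_capacity a W \<le> LY" if "a \<in> A" for a
    unfolding LY_def using that A by (intro renyi_capacity_le_ln_card[OF W]) auto
  have LY_le: "LY \<le> LY / \<alpha>0" using LY \<alpha>0 by (simp add: pos_le_divide_eq mult_left_le)
  have \<eta>0: "0 \<le> \<eta>" unfolding \<eta>_def using \<alpha>0 lnl \<xi> by (intro add_nonneg_nonneg divide_nonneg_pos) auto
  show ?thesis
    unfolding E_def[symmetric]
  proof (rule moment_bound_block[OF W A(1,2) \<alpha>0(1) A(6) \<alpha>1, where \<mu> = \<mu>, folded N_def])
    show "\<exists>a\<in>A. \<alpha>0 \<le> a \<and> l * renyi_capacity a W + ln N \<le> l * R - \<xi>"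
      using A(4) R N by (intro bexI[of _ \<alpha>0]) auto
    show "\<exists>a\<in>A. \<alpha> \<le> a \<and> (1 - \<alpha>) * (l * renyi_capacity a W + ln N - (l * R - \<xi>)) \<le> \<alpha> * (l * E + \<eta>)"
      if \<alpha>: "\<alpha>0 \<le> \<alpha>" "\<alpha> \<le> \<alpha>1" for \<alpha>
    proof -
      obtain a where a: "a \<in> A" "\<alpha> \<le> a" "a \<le> \<alpha> + 1 / real l" using near[OF \<alpha>] by blast
      have a01: "0 < a" "a < 1" "\<alpha>0 \<le> a" using a(1,2) A(2) \<alpha> by auto
      have \<alpha>01: "0 < \<alpha>" "\<alpha> < 1" using \<alpha> \<alpha>0 \<alpha>1 by auto
      let ?x = "renyi_capacity a W - R"
      have "(1 - a) / a * ?x \<le> E"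
        unfolding E_def using sphere_packing_exp_ge[OF W \<alpha>0 CR a01(1)] .
      moreover have "(1 / \<alpha> - 1 / a) * ?x \<le> LY / \<alpha>0\<^sup>2 / l"
      proof -
        have "(1 / \<alpha> - 1 / a) = (a - \<alpha>) / (\<alpha> * a)" using a01 \<alpha>01 by (simp add: field_simps)
        also have "\<dots> \<le> (1 / real l) / (\<alpha>0 * \<alpha>0)"
          using a a01 \<alpha> \<alpha>0 by (intro frac_le mult_mono) auto
        finally have d: "(1 / \<alpha> - 1 / a) \<le> (1 / real l) / (\<alpha>0 * \<alpha>0)" .
        have d0: "0 \<le> 1 / \<alpha> - 1 / a" using a(2) \<alpha>01 by (simp add: frac_le)
        have "(1 / \<alpha> - 1 / a) * ?x \<le> (1 / \<alpha> - 1 / a) * LY"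
          using cap_le[OF a(1)] R0 d0 by (intro mult_left_mono) auto
        also have "\<dots> \<le> (1 / real l) / (\<alpha>0 * \<alpha>0) * LY" using d LY by (intro mult_right_mono)
        finally show ?thesis by (simp add: power2_eq_square field_simps)
      qed
      moreover have "(1 - \<alpha>) / \<alpha> * ?x = (1 - a) / a * ?x + (1 / \<alpha> - 1 / a) * ?x"
        using a01 \<alpha>01 by (simp add: diff_divide_distrib algebra_simps)
      ultimately have "(1 - \<alpha>) / \<alpha> * ?x \<le> E + LY / \<alpha>0\<^sup>2 / l" by linarith
      then have "l * ((1 - \<alpha>) / \<alpha> * ?x) \<le> l * (E + LY / \<alpha>0\<^sup>2 / l)" by (intro mult_left_mono) auto
      then have 1: "l * ((1 - \<alpha>) / \<alpha> * ?x) \<le> l * E + LY / \<alpha>0\<^sup>2" using l0 by (simp add: distrib_left)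
      have "(1 - \<alpha>) / \<alpha> * (ln N + \<xi>) \<le> 1 / \<alpha>0 * (ln (real l + 1) + \<xi>)"
        using \<alpha> \<alpha>0 \<alpha>01 N \<xi> by (intro mult_mono frac_le add_mono) auto
      then have 2: "(1 - \<alpha>) / \<alpha> * (ln N + \<xi>) \<le> ln (real l + 1) / \<alpha>0 + \<xi> / \<alpha>0"
        by (simp add: add_divide_distrib)
      have "z * (l * renyi_capacity a W + ln N - (l * R - \<xi>)) = l * (z * ?x) + z * (ln N + \<xi>)" for z
        by (simp add: algebra_simps)
      from this[of "(1 - \<alpha>) / \<alpha>"]
      have "(1 - \<alpha>) / \<alpha> * (l * renyi_capacity a W + ln N - (l * R - \<xi>)) \<le> l * E + \<eta>"
        using 1 2 unfolding \<eta>_def LY_def by linarith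
      then have "\<alpha> * ((1 - \<alpha>) / \<alpha> * (l * renyi_capacity a W + ln N - (l * R - \<xi>))) \<le> \<alpha> * (l * E + \<eta>)"
        using \<alpha>01 by (intro mult_left_mono) auto
      then show ?thesis using a \<alpha>01 by (intro bexI[of _ a]) auto
    qed
    \<comment> \<open>At the last grid order 1 - \<alpha>1 <= 1 / l cancels the block length,
      leaving at most ln CARD('y) + ln (l + 1), which \<open>\<alpha>0 * \<eta>\<close>
      covers.\<close>
    have "(1 - \<alpha>1) * (l * renyi_capacity \<alpha>1 W + ln N) \<le> \<alpha>1 * (l * E + \<eta>)"
    proof -
      have "0 \<le> renyi_capacity \<alpha>1 W" using A \<alpha>0 \<alpha>1 by (intro renyi_capacity_nonneg[OF W]) auto
      then have "(1 - \<alpha>1) * (l * renyi_capacity \<alpha>1 W + ln N) \<le> 1 / l * (l * LY + ln (real l + 1))"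
        using A cap_le[OF A(5)] N l0 \<alpha>1 by (intro mult_mono add_mono) auto
      also have "\<dots> = LY + 1 / l * ln (real l + 1)" using l0 by (simp add: field_simps)
      also have "\<dots> \<le> LY + ln (real l + 1)"
        using l lnl mult_right_mono[of "1 / real l" 1 "ln (real l + 1)"] by simp
      also have "\<dots> \<le> \<alpha>0 * \<eta>"
      proof -
        have "\<alpha>0 * \<eta> = LY / \<alpha>0 + ln (real l + 1) + \<xi>"
          unfolding \<eta>_def LY_def using \<alpha>0 by (simp add: power2_eq_square field_simps)
        then show ?thesis using LY_le \<xi> by linarith
      qed
      also have "\<dots> \<le> \<alpha>1 * (l * E + \<eta>)" using A(6) \<alpha>0 E0 \<eta>0 by (intro mult_mono) auto
      finally show ?thesis .
    qed
    then show "\<exists>a\<in>A. \<alpha>1 \<le> a \<and> (1 - \<alpha>1) * (l * renyi_capacity a W + ln N) \<le> \<alpha>1 * (l * E + \<eta>)"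
      using A(5) by blast
    \<comment> \<open>The middle summand l pays for ln N, as ln (l + 1) <= l.\<close>
    have c: "c = l * LY + l + l * \<mu>" by (simp add: c_def LY_def algebra_simps)
    have "0 \<le> l * LY" "0 \<le> l * \<mu>" using LY \<mu>(2) by auto
    then show "l * ln CARD('y) + ln N \<le> c" "l * \<mu> \<le> c" "0 \<le> c"
      unfolding c LY_def[symmetric] using N lnl by linarith+
  qed (use \<mu> s in auto)
qed

text \<open>A sum of absolute values dominates each of them; zero entries of W add nothing, as
  \<open>ln 0 = 0\<close>.\<close>

lemma ex_channel_lower_bound:
  fixes W :: "'x::finite \<Rightarrow> 'y::finite \<Rightarrow> real"
  obtains \<mu> where "0 \<le> \<mu>" "\<And>x y. 0 < W x y \<Longrightarrow> exp (- \<mu>) \<le> W x y"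
proof
  let ?\<mu> = "\<Sum>(x, y)\<in>UNIV. \<bar>ln (W x y)\<bar>"
  show "0 \<le> ?\<mu>" by (intro sum_nonneg) auto
  fix x y assume pos: "0 < W x y"
  have "\<bar>ln (W x y)\<bar> \<le> ?\<mu>"
    using member_le_sum[of "(x, y)" UNIV "\<lambda>(x, y). \<bar>ln (W x y)\<bar>"] by auto
  then show "exp (- ?\<mu>) \<le> W x y" using pos by (subst ln_ge_iff[symmetric]) auto
qed

text \<open>\<open>I\<close> and \<open>II\<close> make each Markov term of
  \<open>avg_error_ge\<close> at most 1/4, and \<theta> = n R - ln 4 makes the list term exactly
  1/4. The remaining factor 1/4 is compensated by the - ln 4 in \<delta>. The shares r R and r E of
  the leftover letters are nonnegative and dropped.\<close>

lemma sphere_packing_blocks: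
  fixes W :: "'x::finite \<Rightarrow> 'y::finite \<Rightarrow> real" and n k l r M L :: nat and R E c s \<eta> \<xi> \<Delta> :: real
  assumes W: "discrete_channel W" and \<alpha>0: "0 < \<alpha>0" "\<alpha>0 < 1" and code: "is_list_code n M L f \<psi>"
    and n: "n = k * l + r" "1 \<le> n" and l: "1 \<le> l" and \<xi>: "0 \<le> \<xi>"
  defines "R \<equiv> ln (real M / real L) / real n" and "E \<equiv> sphere_packing_exp R W"
  assumes R: "l * renyi_capacity \<alpha>0 W + ln (real l + 1) + \<xi> \<le> l * R"
    and \<mu>: "\<And>x y. 0 < W x y \<Longrightarrow> exp (- \<mu>) \<le> W x y" "0 \<le> \<mu>"
  defines "c \<equiv> (ln CARD('y) + 1 + \<mu>) * l"
    and "\<eta> \<equiv> ln CARD('y) / \<alpha>0\<^sup>2 + ln (real l + 1) / \<alpha>0 + \<xi> / \<alpha>0"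
  assumes s: "0 < s" "s * c \<le> 1"
    and I: "k * (s * (c\<^sup>2 + 1)) + r * ln CARD('y) + ln 4 + ln 4 / s \<le> k * \<xi>"
    and II: "k * \<eta> + k * (s * (c\<^sup>2 + 1)) + ln 4 / s + ln 4 \<le> n * \<Delta>"
  shows "exp (- real n * (E + \<Delta>)) \<le> avg_error W n M f \<psi>"
proof -
  define LY where "LY = ln (real CARD('y))"
  have l0: "0 < real l" using l by simp
  have "0 \<le> ln (real l + 1)" by simp
  then have "l * renyi_capacity \<alpha>0 W \<le> l * R" using R \<xi> by linarith
  then have CR: "renyi_capacity \<alpha>0 W \<le> R" using l0 by simp
  have R0: "0 \<le> R" using renyi_capacity_nonneg[OF W \<alpha>0(1)] \<alpha>0 CR by linarith
  have E0: "0 \<le> E" unfolding E_def using sphere_packing_exp_nonneg[OF W \<alpha>0 CR] .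
  have LM: "1 \<le> L" "L \<le> M" using code by (auto simp: is_list_code_def)
  define v where "v = s * (c\<^sup>2 + 1)"
  define b where "b = k * (s * (l * R - \<xi>) + s\<^sup>2 * (c\<^sup>2 + 1)) + s * (r * LY)"
  define d where "d = k * (s * (l * E + \<eta>) + s\<^sup>2 * (c\<^sup>2 + 1))"
  have mb: "moment_bound W n s b d"
    unfolding n(1) b_def d_def LY_def c_def \<eta>_def E_def using s
    by (intro moment_bound_power moment_bound_sphere_packing W \<alpha>0 l \<xi> R \<mu>) (auto simp: c_def)
  define \<theta> where "\<theta> = n * R - ln 4"
  define \<delta> where "\<delta> = n * (E + \<Delta>) - ln 4"
  have "b = s * (k * (l * R - \<xi>) + k * v + r * LY)"
    by (simp add: b_def v_def power2_eq_square algebra_simps)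
  also have "\<dots> \<le> s * (\<theta> - ln 4 / s)"
  proof (intro mult_left_mono)
    have "n * R = k * l * R + r * R" by (simp add: n(1) algebra_simps)
    moreover have "0 \<le> r * R" using R0 by simp
    ultimately show "k * (l * R - \<xi>) + k * v + r * LY \<le> \<theta> - ln 4 / s"
      using I unfolding \<theta>_def v_def LY_def by (simp add: algebra_simps)
  qed (use s in simp)
  finally have "exp (b - s * \<theta>) \<le> exp (- ln 4)" using s by (simp add: algebra_simps)
  then have b4: "exp (b - s * \<theta>) \<le> 1 / 4" by (simp add: exp_minus)
  have "d = s * (k * (l * E + \<eta>) + k * v)"
    by (simp add: d_def v_def power2_eq_square algebra_simps)
  also have "\<dots> \<le> s * (\<delta> - ln 4 / s)"
  proof (intro mult_left_mono)
    have "n * E = k * l * E + r * E" by (simp add: n(1) algebra_simps)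
    moreover have "0 \<le> r * E" using E0 by simp
    ultimately show "k * (l * E + \<eta>) + k * v \<le> \<delta> - ln 4 / s"
      using II unfolding \<delta>_def v_def by (simp add: algebra_simps)
  qed (use s in simp)
  finally have "exp (d - s * \<delta>) \<le> exp (- ln 4)" using s by (simp add: algebra_simps)
  then have d4: "exp (d - s * \<delta>) \<le> 1 / 4" by (simp add: exp_minus)
  have "exp \<theta> = (M / L) / 4"
    using LM n(2) by (simp add: \<theta>_def R_def exp_diff)
  then have L4: "exp \<theta> * (real L / real M) = 1 / 4" using LM by simp
  have "exp (- real n * (E + \<Delta>)) = exp (- \<delta>) * exp (- ln 4)"
    unfolding \<delta>_def exp_add[symmetric] by (simp add: algebra_simps)
  also have "\<dots> = exp (- \<delta>) * (1 / 4)" by (simp add: exp_minus)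
  also have "\<dots> \<le> exp (- \<delta>) * (1 - exp (d - s * \<delta>) - exp (b - s * \<theta>) - exp \<theta> * (real L / real M))"
  proof (rule mult_left_mono)
    show "1 / 4 \<le> 1 - exp (d - s * \<delta>) - exp (b - s * \<theta>) - exp \<theta> * (real L / real M)"
      using b4 d4 L4 by linarith
  qed simp
  also have "\<dots> \<le> avg_error W n M f \<psi>" by (rule avg_error_ge[OF W code mb s(1)])
  finally show ?thesis .
qed

lemma ln_4_le: "ln (4::real) \<le> 2"
proof -
  have "ln (4::real) = 2 * ln 2" using ln_realpow[of "2::real" 2] by simp
  then show ?thesis using ln_2_less_1 by simp
qed

text \<open>With \<open>x = n\<^bsup>1/4\<^esup>\<close> there are about \<open>x\<^sup>2\<close> blocks of length about \<open>x\<^sup>2\<close>; the reduction \<open>\<xi>\<close> of the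
  rate of a block and the moment order \<open>s\<close> are of orders \<open>x\<close> and \<open>x\<^sup>-\<^sup>3\<close>. All losses are then
  \<open>O(x\<^sup>3)\<close> and are absorbed by \<open>n \<Delta> = x\<^sup>3 ln n\<close>.\<close>

lemma sphere_packing_feedback:
  fixes W :: "'x::finite \<Rightarrow> 'y::finite \<Rightarrow> real" and n M L :: nat and R \<Delta> c0 :: real
  assumes W: "discrete_channel W" and \<alpha>0: "0 < \<alpha>0" "\<alpha>0 < 1" and code: "is_list_code n M L f \<psi>"
    and \<mu>: "\<And>x y. 0 < W x y \<Longrightarrow> exp (- \<mu>) \<le> W x y" "0 \<le> \<mu>"
  defines "c0 \<equiv> ln CARD('y) + 1 + \<mu>" and "R \<equiv> ln (real M / real L) / real n"
    and "\<Delta> \<equiv> ln (real n) / real n powr (1/4)"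
  assumes R: "renyi_capacity \<alpha>0 W + \<Delta> \<le> R" and n: "256 \<le> n" "92 * c0 / \<alpha>0 \<le> ln (real n)"
  shows "exp (- real n * (sphere_packing_exp R W + 1 / \<alpha>0 * \<Delta>)) \<le> avg_error W n M f \<psi>"
proof -
  define LY where "LY = ln (real CARD('y))"
  define x where "x = real n powr (1/4)"
  define h where "h = ln (real n)"
  have n0: "0 < real n" using n by simp
  have x4: "real n = x ^ 4"
    using n0 by (simp add: x_def powr_powr flip: powr_numeral)
  have x0: "0 < x" using n0 by (simp add: x_def)
  \<comment> \<open>256 = 4^4, so x >= 4.\<close>
  have "(4::real) ^ 4 \<le> x ^ 4" using n(1) by (simp flip: x4)
  then have x: "4 \<le> x" using x0 by (intro power_le_imp_le_base[of 4 3]) (auto simp: numeral_eq_Suc)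
  have LY: "0 \<le> LY" by (simp add: LY_def)
  have c0: "1 \<le> c0" "LY \<le> c0" using LY \<mu>(2) by (auto simp: c0_def LY_def)
  have h: "92 * c0 \<le> \<alpha>0 * h" using n(2) \<alpha>0 by (simp add: h_def pos_divide_le_eq mult.commute)
  have h0: "0 \<le> h" using n by (simp add: h_def)
  have "\<alpha>0 * h \<le> h" using h0 \<alpha>0 by (simp add: mult_left_le_one_le)
  then have h92: "92 * c0 \<le> h" using h by linarith
  define l where "l = nat \<lfloor>x\<^sup>2\<rfloor>"
  define k where "k = n div l"
  define r where "r = n mod l"
  have x16: "16 \<le> x\<^sup>2" using power_mono[OF x, of 2] by simp
  have l_le: "real l \<le> x\<^sup>2" and l_gt: "x\<^sup>2 - 1 < real l" using x16 by (auto simp: l_def)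
  have l1: "1 \<le> l" using l_gt x16 by linarith
  have l_half: "x\<^sup>2 / 2 \<le> l" using l_gt x16 by linarith
  have nkl: "n = k * l + r" by (simp add: k_def r_def)
  have "r < l" using l1 by (simp add: r_def)
  then have r_le: "real r \<le> x\<^sup>2" using l_le by linarith
  have sq: "real n = x\<^sup>2 * x\<^sup>2" by (simp add: x4 flip: power_add)
  have "real k * real l \<le> real n" by (simp add: nkl)
  then have "real k * (x\<^sup>2 / 2) \<le> x\<^sup>2 * x\<^sup>2" using mult_left_mono[OF l_half, of k] sq by simp
  then have k_le: "real k \<le> 2 * x\<^sup>2" using x0 by (simp add: power2_eq_square)
  have k_ge: "x\<^sup>2 / 2 \<le> k"
  proof -
    have "real n = real k * real l + real r" using nkl by (metis of_nat_add of_nat_mult)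
    then have "x\<^sup>2 * x\<^sup>2 \<le> (real k + 1) * real l" using \<open>r < l\<close> sq by (simp add: algebra_simps)
    also have "\<dots> \<le> (real k + 1) * x\<^sup>2" using l_le by (intro mult_left_mono) auto
    finally have "x\<^sup>2 \<le> real k + 1"
      by (rule mult_right_le_imp_le) (use x0 in simp)
    then show ?thesis using x16 by linarith
  qed
  \<comment> \<open>The left side of \<open>I\<close> is at most (4 + 1 + 2 + 2) c0 x^3 and there
    are at least x^2 / 2 blocks, whence 18 = 2 * 9.\<close>
  define \<xi> where "\<xi> = 18 * c0 * x"
  \<comment> \<open>Balances k s c^2, of order s x^6, against 1 / s.\<close>
  define s where "s = 1 / (c0 * x ^ 3)"
  define c where "c = c0 * l"
  have \<xi>0: "0 \<le> \<xi>" using c0 x0 by (simp add: \<xi>_def)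
  have s0: "0 < s" using c0 x0 by (simp add: s_def)
  have c_le: "0 \<le> c" "c \<le> c0 * x\<^sup>2" using c0 l_le by (auto simp: c_def)
  have sc: "s * c \<le> 1"
  proof -
    have "s * c \<le> s * (c0 * x\<^sup>2)" using s0 c_le by (intro mult_left_mono) auto
    also have "\<dots> = 1 / x" using c0 x0 by (simp add: s_def power2_eq_square power3_eq_cube field_simps)
    also have "\<dots> \<le> 1" using x by simp
    finally show ?thesis .
  qed
  have one_le: "1 \<le> c0 * x ^ 2" "1 \<le> c0 * x ^ 3"
    using mult_mono[of 1 c0 1 "x ^ 2"] mult_mono[of 1 c0 1 "x ^ 3"] c0 x by (auto simp: one_le_power)
  have v_le: "k * (s * (c\<^sup>2 + 1)) \<le> 4 * c0 * x ^ 3"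
  proof -
    have "c\<^sup>2 \<le> (c0 * x\<^sup>2)\<^sup>2" using c_le by (intro power_mono) auto
    moreover have "1 \<le> (c0 * x\<^sup>2)\<^sup>2" using one_le(1) by (intro one_le_power)
    ultimately have "c\<^sup>2 + 1 \<le> 2 * (c0 * x\<^sup>2)\<^sup>2" by linarith
    then have "k * (s * (c\<^sup>2 + 1)) \<le> (2 * x\<^sup>2) * (s * (2 * (c0 * x\<^sup>2)\<^sup>2))"
      using k_le s0 by (intro mult_mono mult_left_mono) auto
    also have "\<dots> = 4 * c0 * x ^ 3"
      using c0 x0 by (simp add: s_def field_simps flip: power_mult power_add) (simp add: eval_nat_numeral field_simps)
    finally show ?thesis .
  qed
  have ln4: "ln 4 \<le> 2 * (c0 * x ^ 3)" "ln 4 / s \<le> 2 * (c0 * x ^ 3)"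
    using ln_4_le one_le(2) by (auto simp: s_def mult_right_mono)
  have "r * LY \<le> x\<^sup>2 * c0" using r_le c0 LY by (intro mult_mono) auto
  also have "\<dots> \<le> x\<^sup>2 * c0 * x" using mult_left_mono[of 1 x "x\<^sup>2 * c0"] c0 x by simp
  also have "\<dots> = c0 * x ^ 3" by (simp add: power2_eq_square power3_eq_cube)
  finally have rLY: "r * LY \<le> c0 * x ^ 3" .
  have I: "k * (s * (c\<^sup>2 + 1)) + r * ln CARD('y) + ln 4 + ln 4 / s \<le> k * \<xi>"
  proof -
    have "9 * (c0 * x ^ 3) = x\<^sup>2 / 2 * \<xi>" by (simp add: \<xi>_def power2_eq_square power3_eq_cube)
    also have "\<dots> \<le> k * \<xi>" using k_ge \<xi>0 by (intro mult_right_mono)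
    finally show ?thesis using v_le rLY ln4 unfolding LY_def by linarith
  qed
  have ln_l: "ln (real l + 1) \<le> h"
  proof -
    have "real l + 1 \<le> x\<^sup>2 * x\<^sup>2"
      using l_le x16 mult_right_mono[of 16 "x\<^sup>2" "x\<^sup>2"] by linarith
    then show ?thesis unfolding h_def sq by (subst ln_le_cancel_iff) auto
  qed
  have D: "\<Delta> = h / x" by (simp add: \<Delta>_def h_def x_def)
  have H1: "l * renyi_capacity \<alpha>0 W + ln (real l + 1) + \<xi> \<le> l * R"
  proof -
    \<comment> \<open>Each summand is at most x h / 4: the first as x >= 4, the second as 18 c0 <=
      18 h / 92.\<close>
    have "h + \<xi> \<le> x / 2 * h"
    proof -
      have "4 * h \<le> x * h" using x h0 by (intro mult_right_mono)
      moreover have "x * (92 * c0) \<le> x * h" using h92 x0 by (intro mult_left_mono) auto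
      ultimately show ?thesis using \<xi>0 by (simp add: \<xi>_def algebra_simps)
    qed
    also have "\<dots> = x\<^sup>2 / 2 * \<Delta>" using x0 by (simp add: D power2_eq_square)
    also have "\<dots> \<le> l * \<Delta>" using l_half h0 x0 by (intro mult_right_mono) (auto simp: D)
    finally have "ln (real l + 1) + \<xi> \<le> l * \<Delta>" using ln_l by linarith
    moreover have "l * (renyi_capacity \<alpha>0 W + \<Delta>) \<le> l * R" using R by (intro mult_left_mono) auto
    ultimately show ?thesis by (simp add: algebra_simps)
  qed
  define \<eta> where "\<eta> = ln (real CARD('y)) / \<alpha>0\<^sup>2 + ln (real l + 1) / \<alpha>0 + \<xi> / \<alpha>0"
  have II: "k * \<eta> + k * (s * (c\<^sup>2 + 1)) + ln 4 / s + ln 4 \<le> n * (1 / \<alpha>0 * \<Delta>)"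
  proof -
    have "\<alpha>0 * \<eta> = LY / \<alpha>0 + ln (real l + 1) + \<xi>"
      using \<alpha>0 by (simp add: \<eta>_def LY_def power2_eq_square field_simps)
    moreover have "LY / \<alpha>0 \<le> c0 / \<alpha>0" using c0 \<alpha>0 by (intro divide_right_mono) auto
    moreover have "c0 / \<alpha>0 \<le> h / 92" using h \<alpha>0 by (simp add: field_simps)
    ultimately have "\<alpha>0 * \<eta> \<le> h / 92 + h + 18 * c0 * x" using ln_l unfolding \<xi>_def by linarith
    moreover have "0 \<le> h / 92 + h + 18 * c0 * x" using h0 c0 x0 by simp
    ultimately have "k * (\<alpha>0 * \<eta>) \<le> 2 * x\<^sup>2 * (h / 92 + h + 18 * c0 * x)"
      using k_le by (meson mult_left_mono mult_right_mono of_nat_0_le_iff order_trans)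
    also have "\<dots> = 93 / 46 * (x\<^sup>2 * h) + 36 * (c0 * x ^ 3)"
      by (simp add: power2_eq_square power3_eq_cube algebra_simps)
    finally have 1: "k * (\<alpha>0 * \<eta>) \<le> 93 / 46 * (x\<^sup>2 * h) + 36 * (c0 * x ^ 3)" .
    have "4 * (x\<^sup>2 * h) \<le> x * (x\<^sup>2 * h)" using x h0 by (intro mult_right_mono) auto
    then have 2: "x\<^sup>2 * h \<le> x ^ 3 * h / 4" by (simp add: power2_eq_square power3_eq_cube)
    have "92 * c0 * x ^ 3 \<le> h * x ^ 3" using h92 x0 by (intro mult_right_mono) auto
    then have 3: "92 * (c0 * x ^ 3) \<le> x ^ 3 * h" by (simp add: mult_ac)
    have 4: "\<alpha>0 * (k * (s * (c\<^sup>2 + 1)) + ln 4 / s + ln 4) \<le> 1 * (8 * (c0 * x ^ 3))"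
      using \<alpha>0 v_le ln4 s0 by (intro mult_mono) (auto intro!: add_nonneg_nonneg)
    \<comment> \<open>The constant 92 is sufficient here: in units of Y = x^3 h the total is at most
      93 / 184 + 44 / 92 = 181 / 184.\<close>
    have sum: "a + b \<le> Y" if "a \<le> 93 / 46 * X + 36 * Z" "b \<le> 1 * (8 * Z)" "X \<le> Y / 4" "92 * Z \<le> Y" "0 \<le> Y"
      for a b X Y Z :: real using that by linarith
    have "\<alpha>0 * (k * \<eta> + k * (s * (c\<^sup>2 + 1)) + ln 4 / s + ln 4)
        = k * (\<alpha>0 * \<eta>) + \<alpha>0 * (k * (s * (c\<^sup>2 + 1)) + ln 4 / s + ln 4)" by (simp add: algebra_simps)
    also have "\<dots> \<le> x ^ 3 * h" by (rule sum[OF 1 4 2 3]) (use x0 h0 in simp)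
    also have "x ^ 3 * h = n * \<Delta>" using x0 by (simp add: D x4 eval_nat_numeral)
    also have "n * \<Delta> = \<alpha>0 * (n * (1 / \<alpha>0 * \<Delta>))" using \<alpha>0 by simp
    finally show ?thesis by (rule mult_left_le_imp_le) (rule \<alpha>0)
  qed
  have "1 \<le> n" using n by simp
  then show ?thesis
    by (rule sphere_packing_blocks[OF W \<alpha>0 code nkl _ l1 \<xi>0 _ \<mu> s0, folded R_def c0_def c_def \<eta>_def])
      (fact H1, assumption, fact sc, fact I, fact II)
qed

theorem theorem4:
  fixes W :: "'x::finite \<Rightarrow> 'y::finite \<Rightarrow> real"
    and \<alpha>0 \<alpha>1 :: real
    and M L :: "nat \<Rightarrow> nat"
    and f :: "nat \<Rightarrow> nat \<Rightarrow> 'y list \<Rightarrow> 'x"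
    and \<psi> :: "nat \<Rightarrow> 'y list \<Rightarrow> nat set"
    and n0 :: nat
  assumes W: "discrete_channel W"
    and alphas: "0 < \<alpha>0" "\<alpha>0 < \<alpha>1" "\<alpha>1 < 1"
    and codes: "\<forall>n\<ge>1. is_list_code n (M n) (L n) (f n) (\<psi> n)"
    and rate: "\<forall>n\<ge>n0.
        renyi_capacity \<alpha>1 W \<ge> ln (real (M n) / real (L n)) / real n \<and>
        ln (real (M n) / real (L n)) / real n \<ge>
          renyi_capacity \<alpha>0 W + ln (real n) / real n powr (1/4)"
  shows "\<exists>n1\<ge>n0. \<forall>n\<ge>n1.
           avg_error W n (M n) (f n) (\<psi> n) \<ge>
             exp (- real n * (sphere_packing_exp (ln (real (M n) / real (L n)) / real n) W
                              + (1 / \<alpha>0) * (ln (real n) / real n powr (1/4))))"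
proof -
  obtain \<mu> where \<mu>: "0 \<le> \<mu>" "\<And>x y. 0 < W x y \<Longrightarrow> exp (- \<mu>) \<le> W x y"
    using ex_channel_lower_bound[of W] by blast
  define c where "c = 92 * (ln CARD('y) + 1 + \<mu>) / \<alpha>0"
  obtain n' :: nat where n': "exp c \<le> real n'" using real_arch_simple by blast
  \<comment> \<open>\<open>n'\<close> ensures ln n >= c, and 256 ensures x >= 4; lengths from 256 on
    also fall under the assumption on the codes, which starts at length 1.\<close>
  show ?thesis
  proof (intro exI[of _ "max n0 (max 256 n')"] conjI allI impI)
    fix n assume n: "max n0 (max 256 n') \<le> n"
    then have "exp c \<le> real n" using n' by simp
    moreover have "0 < real n" using n by simp
    ultimately have "c \<le> ln (real n)" by (simp add: ln_ge_iff)
    then show "exp (- real n * (sphere_packing_exp (ln (real (M n) / real (L n)) / real n) W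
        + (1 / \<alpha>0) * (ln (real n) / real n powr (1/4)))) \<le> avg_error W n (M n) (f n) (\<psi> n)"
      using n alphas codes rate \<mu>
      by (intro sphere_packing_feedback[where \<mu> = \<mu>] W) (auto simp: c_def)
  qed simp
qed

end
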